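(* Multistage Knapsack with nonnegative integer weights and capacities is solvable in time $O(T(2C_{max}+2)^Tn)$, where $C_{max}=\max\{C_t: t=1,\dots,T\}$.
   Context: Multistage Knapsack: given a time horizon $T\ge 1$, objects $N=\{1,\dots,n\}$, for each $t\in\{1,\dots,T\}$ and $i\in N$ a profit $p_{ti}$ and a weight $w_{ti}$, for each $t\in\{1,\dots,T-1\}$ and $i\in N$ a bonus $B_{ti}\ge0$, and capacities $C_t$. A solution is a sequence $S=(S_1,\dots,S_T)$ of subsets of $N$ with $\sum_{i\in S_t}w_{ti}\le C_t$ for all $t$; its value is $\sum_{t=1}^T\sum_{i\in S_t}p_{ti}+\sum_{t=1}^{T-1}\sum_{i\in\Delta_t}B_{ti}$, where $\Delta_t=(S_t\cap S_{t+1})\cup(\overline{S_t}\cap\overline{S_{t+1}})$; the goal is to compute a solution of maximum value. *)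

theory Defs
  imports Complex_Main
begin

section \<open>Multistage Knapsack with nonnegative integer weights and capacities\<close>

text \<open>Times range over 1..T and objects over 1..n; entries outside these ranges are never used.\<close>

record mk_instance =
  horizon :: nat
  num_objects :: nat
  capacity :: "nat \<Rightarrow> nat"
  weight :: "nat \<Rightarrow> nat \<Rightarrow> nat"
  profit :: "nat \<Rightarrow> nat \<Rightarrow> real"
  bonus :: "nat \<Rightarrow> nat \<Rightarrow> real"

definition objects :: "mk_instance \<Rightarrow> nat set" where
  "objects I = {1..num_objects I}"

definition valid_instance :: "mk_instance \<Rightarrow> bool" where
  "valid_instance I \<longleftrightarrow>
     horizon I \<ge> 1 \<and> (\<forall>t\<in>{1..horizon I - 1}. \<forall>i\<in>objects I. bonus I t i \<ge> 0)"

definition max_capacity :: "mk_instance \<Rightarrow> nat" where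
  "max_capacity I = Max (capacity I ` {1..horizon I})"

definition is_solution :: "mk_instance \<Rightarrow> (nat \<Rightarrow> nat set) \<Rightarrow> bool" where
  "is_solution I S \<longleftrightarrow>
     (\<forall>t\<in>{1..horizon I}. S t \<subseteq> objects I \<and> (\<Sum>i\<in>S t. weight I t i) \<le> capacity I t)"

definition stable_objects :: "mk_instance \<Rightarrow> (nat \<Rightarrow> nat set) \<Rightarrow> nat \<Rightarrow> nat set" where
  "stable_objects I S t =
     (S t \<inter> S (t + 1)) \<union> ((objects I - S t) \<inter> (objects I - S (t + 1)))"

definition solution_value :: "mk_instance \<Rightarrow> (nat \<Rightarrow> nat set) \<Rightarrow> real" where
  "solution_value I S =
     (\<Sum>t\<in>{1..horizon I}. \<Sum>i\<in>S t. profit I t i)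
     + (\<Sum>t\<in>{1..horizon I - 1}. \<Sum>i\<in>stable_objects I S t. bonus I t i)"

definition is_optimal_solution :: "mk_instance \<Rightarrow> (nat \<Rightarrow> nat set) \<Rightarrow> bool" where
  "is_optimal_solution I S \<longleftrightarrow>
     is_solution I S \<and> (\<forall>S'. is_solution I S' \<longrightarrow> solution_value I S' \<le> solution_value I S)"


section \<open>Model of computation: a unit-cost random access machine\<close>

text \<open>
  Programs are while programs over finitely many unbounded arrays of integers and of reals,
  accessed by computed integer indices; cell 0 of an array serves as a scalar variable.
  Every constant, memory access, arithmetic operation, comparison, connective and control
  transfer costs one unit. Arithmetic is limited to addition and subtraction (no multiplication,
  no shifts, no conversion between reals and integers), so that charging one unit per operation
  is not exploitable. The only real constant is 0: arbitrary real constants in a program could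
  encode infinite advice.
\<close>

record state =
  imem :: "string \<Rightarrow> int \<Rightarrow> int"
  rmem :: "string \<Rightarrow> int \<Rightarrow> real"

datatype iexp =
    IConst int
  | IGet string iexp
  | IAdd iexp iexp
  | ISub iexp iexp

datatype rexp =
    RZero
  | RGet string iexp
  | RAdd rexp rexp
  | RSub rexp rexp

datatype bexp =
    ILess iexp iexp
  | RLess rexp rexp
  | BNot bexp
  | BAnd bexp bexp

datatype com =
    Skip
  | IPut string iexp iexp
  | RPut string iexp rexp
  | Seq com com
  | Cond bexp com com
  | While bexp com

primrec ival :: "iexp \<Rightarrow> state \<Rightarrow> int" where
  "ival (IConst k) s = k"
| "ival (IGet a e) s = imem s a (ival e s)"
| "ival (IAdd e1 e2) s = ival e1 s + ival e2 s"
| "ival (ISub e1 e2) s = ival e1 s - ival e2 s"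

primrec rval :: "rexp \<Rightarrow> state \<Rightarrow> real" where
  "rval RZero s = 0"
| "rval (RGet a e) s = rmem s a (ival e s)"
| "rval (RAdd e1 e2) s = rval e1 s + rval e2 s"
| "rval (RSub e1 e2) s = rval e1 s - rval e2 s"

primrec bval :: "bexp \<Rightarrow> state \<Rightarrow> bool" where
  "bval (ILess e1 e2) s \<longleftrightarrow> ival e1 s < ival e2 s"
| "bval (RLess e1 e2) s \<longleftrightarrow> rval e1 s < rval e2 s"
| "bval (BNot b) s \<longleftrightarrow> \<not> bval b s"
| "bval (BAnd b1 b2) s \<longleftrightarrow> bval b1 s \<and> bval b2 s"

primrec icost :: "iexp \<Rightarrow> nat" where
  "icost (IConst k) = 1"
| "icost (IGet a e) = 1 + icost e"
| "icost (IAdd e1 e2) = 1 + icost e1 + icost e2"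
| "icost (ISub e1 e2) = 1 + icost e1 + icost e2"

primrec rcost :: "rexp \<Rightarrow> nat" where
  "rcost RZero = 1"
| "rcost (RGet a e) = 1 + icost e"
| "rcost (RAdd e1 e2) = 1 + rcost e1 + rcost e2"
| "rcost (RSub e1 e2) = 1 + rcost e1 + rcost e2"

primrec bcost :: "bexp \<Rightarrow> nat" where
  "bcost (ILess e1 e2) = 1 + icost e1 + icost e2"
| "bcost (RLess e1 e2) = 1 + rcost e1 + rcost e2"
| "bcost (BNot b) = 1 + bcost b"
| "bcost (BAnd b1 b2) = 1 + bcost b1 + bcost b2"

definition iupdate :: "string \<Rightarrow> int \<Rightarrow> int \<Rightarrow> state \<Rightarrow> state" where
  "iupdate a j v s = s\<lparr>imem := (imem s)(a := (imem s a)(j := v))\<rparr>"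

definition rupdate :: "string \<Rightarrow> int \<Rightarrow> real \<Rightarrow> state \<Rightarrow> state" where
  "rupdate a j v s = s\<lparr>rmem := (rmem s)(a := (rmem s a)(j := v))\<rparr>"

text \<open>\<open>runs c s k s'\<close>: started in \<open>s\<close>, the program \<open>c\<close> halts in \<open>s'\<close> at total cost \<open>k\<close>.\<close>

inductive runs :: "com \<Rightarrow> state \<Rightarrow> nat \<Rightarrow> state \<Rightarrow> bool" where
  Skip: "runs Skip s 1 s"
| IPut: "runs (IPut a e1 e2) s (1 + icost e1 + icost e2) (iupdate a (ival e1 s) (ival e2 s) s)"
| RPut: "runs (RPut a e1 e2) s (1 + icost e1 + rcost e2) (rupdate a (ival e1 s) (rval e2 s) s)"
| Seq: "runs c1 s1 k1 s2 \<Longrightarrow> runs c2 s2 k2 s3 \<Longrightarrow> runs (Seq c1 c2) s1 (k1 + k2) s3"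
| CondTrue: "bval b s \<Longrightarrow> runs c1 s k s' \<Longrightarrow> runs (Cond b c1 c2) s (1 + bcost b + k) s'"
| CondFalse: "\<not> bval b s \<Longrightarrow> runs c2 s k s' \<Longrightarrow> runs (Cond b c1 c2) s (1 + bcost b + k) s'"
| WhileFalse: "\<not> bval b s \<Longrightarrow> runs (While b c) s (1 + bcost b) s"
| WhileTrue: "bval b s1 \<Longrightarrow> runs c s1 k1 s2 \<Longrightarrow> runs (While b c) s2 k2 s3
    \<Longrightarrow> runs (While b c) s1 (1 + bcost b + k1 + k2) s3"

inductive_cases SkipE: "runs Skip s k s'"
inductive_cases IPutE: "runs (IPut a e1 e2) s k s'"
inductive_cases RPutE: "runs (RPut a e1 e2) s k s'"
inductive_cases SeqE: "runs (Seq c1 c2) s k s'"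
inductive_cases CondE: "runs (Cond b c1 c2) s k s'"
inductive_cases WhileE: "runs (While b c) s k s'"

lemma runs_deterministic:
  "runs c s k s' \<Longrightarrow> runs c s k2 s2 \<Longrightarrow> k2 = k \<and> s2 = s'"
proof (induction arbitrary: k2 s2 rule: runs.induct)
  case Skip
  then show ?case by (auto elim: SkipE)
next
  case IPut
  then show ?case by (auto elim: IPutE)
next
  case RPut
  then show ?case by (auto elim: RPutE)
next
  case (Seq c1 s1 k1 s2' c2 k2' s3)
  from Seq.prems show ?case by (rule SeqE) (auto dest!: Seq.IH)
next
  case (CondTrue b s c1 k s' c2)
  from CondTrue.prems show ?case by (rule CondE) (use CondTrue.hyps in \<open>auto dest!: CondTrue.IH\<close>)
next
  case (CondFalse b s c2 k s' c1)
  from CondFalse.prems show ?case by (rule CondE) (use CondFalse.hyps in \<open>auto dest!: CondFalse.IH\<close>)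
next
  case (WhileFalse b s c)
  from WhileFalse.prems show ?case by (rule WhileE) (use WhileFalse.hyps in \<open>auto\<close>)
next
  case (WhileTrue b s1 c k1 s2' k2' s3)
  from WhileTrue.prems show ?case by (rule WhileE) (use WhileTrue.hyps in \<open>auto dest!: WhileTrue.IH\<close>)
qed


section \<open>Input and output of the machine\<close>

definition list_array :: "'a::zero list \<Rightarrow> int \<Rightarrow> 'a" where
  "list_array xs j = (if 0 \<le> j \<and> j < int (length xs) then xs ! nat j else 0)"

text \<open>Families indexed by a time and an object are stored row by row, one row per time.\<close>

definition input_imem :: "mk_instance \<Rightarrow> string \<Rightarrow> int \<Rightarrow> int" where
  "input_imem I = (\<lambda>_ _. 0)
     (''T'' := list_array [int (horizon I)],
      ''n'' := list_array [int (num_objects I)],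
      ''C'' := list_array [int (capacity I t). t \<leftarrow> [1..<horizon I + 1]],
      ''w'' := list_array
        [int (weight I t i). t \<leftarrow> [1..<horizon I + 1], i \<leftarrow> [1..<num_objects I + 1]])"

definition input_rmem :: "mk_instance \<Rightarrow> string \<Rightarrow> int \<Rightarrow> real" where
  "input_rmem I = (\<lambda>_ _. 0)
     (''p'' := list_array
        [profit I t i. t \<leftarrow> [1..<horizon I + 1], i \<leftarrow> [1..<num_objects I + 1]],
      ''B'' := list_array
        [bonus I t i. t \<leftarrow> [1..<horizon I], i \<leftarrow> [1..<num_objects I + 1]])"

definition input_state :: "mk_instance \<Rightarrow> state" where
  "input_state I = \<lparr>imem = input_imem I, rmem = input_rmem I\<rparr>"

text \<open>The output is the 0/1 membership matrix of the solution, in the same row-by-row layout.\<close>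

definition output_solution :: "mk_instance \<Rightarrow> state \<Rightarrow> nat \<Rightarrow> nat set" where
  "output_solution I s t =
     {i \<in> objects I. imem s ''S'' (int ((t - 1) * num_objects I + (i - 1))) = 1}"

end

theory Submission
  imports Defs
begin

text \<open>
  Order the cells \<open>(i, t)\<close> object by object, \<open>j = i * T + t\<close>. A bonus then couples consecutive
  cells of this chain only (between the last cell of an object and the first cell of the next one it
  is 0), so the maximum gain of the first \<open>j\<close> cells depends only on the remaining capacities
  \<open>c\<^sub>t \<le> C\<^sub>t\<close> and on the choice \<open>b\<close> made in the following cell. The pairs \<open>(c, b)\<close> are numbered
  by the mixed-radix code \<open>enc c + b\<close> whose weights are \<open>W\<^sub>0 = 2\<close> and \<open>W\<^sub>t\<^sub>+\<^sub>1 = W\<^sub>t * (C\<^sub>t + 1)\<close>.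
  Taking an object of weight \<open>w\<close> at time \<open>t\<close> subtracts \<open>w * W\<^sub>t\<close> from the code, and is allowed iff
  \<open>code mod W\<^sub>t\<^sub>+\<^sub>1 \<ge> w * W\<^sub>t\<close>, so each of the \<open>L = W\<^sub>T \<le> (2 * C\<^sub>m\<^sub>a\<^sub>x + 2)\<^sup>T\<close> nodes of each
  of the \<open>n * T\<close> layers is processed in constant time. Chosen bits and predecessors are stored, and
  an optimal solution is read off backwards.
\<close>

section \<open>Cost-aware weakest preconditions\<close>

text \<open>The postcondition also receives the cost, so time bound and correctness are proved
  together. Asking for a run makes this total correctness; determinism of \<open>runs\<close> turns
  the rules for basic commands into equivalences.\<close>

definition wp :: "com \<Rightarrow> (nat \<Rightarrow> state \<Rightarrow> bool) \<Rightarrow> state \<Rightarrow> bool" where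
  "wp c Q s \<longleftrightarrow> (\<exists>k s'. runs c s k s' \<and> Q k s')"

lemma wp_Skip [simp]: "wp Skip Q s \<longleftrightarrow> Q 1 s"
  unfolding wp_def by (metis runs.Skip runs_deterministic)

lemma wp_IPut [simp]:
  "wp (IPut a e1 e2) Q s \<longleftrightarrow> Q (1 + icost e1 + icost e2) (iupdate a (ival e1 s) (ival e2 s) s)"
  unfolding wp_def by (metis runs.IPut runs_deterministic)

lemma wp_RPut [simp]:
  "wp (RPut a e1 e2) Q s \<longleftrightarrow> Q (1 + icost e1 + rcost e2) (rupdate a (ival e1 s) (rval e2 s) s)"
  unfolding wp_def by (metis runs.RPut runs_deterministic)

lemma wp_Seq [simp]:
  "wp (Seq c1 c2) Q s \<longleftrightarrow> wp c1 (\<lambda>k1. wp c2 (\<lambda>k2. Q (k1 + k2))) s"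
  unfolding wp_def by (blast elim: SeqE intro: runs.Seq)

lemma wp_Cond [simp]:
  "wp (Cond b c1 c2) Q s \<longleftrightarrow>
     (if bval b s then wp c1 (\<lambda>k. Q (1 + bcost b + k)) s else wp c2 (\<lambda>k. Q (1 + bcost b + k)) s)"
  (is "?l \<longleftrightarrow> ?r")
proof
  assume ?l
  then obtain k s' where "runs (Cond b c1 c2) s k s'" "Q k s'"
    unfolding wp_def by blast
  then show ?r
    by (elim CondE) (auto simp: wp_def)
next
  assume ?r
  then show ?l
    unfolding wp_def by (cases "bval b s") (simp_all only: if_True if_False, (blast intro: CondTrue CondFalse)+)
qed

lemma wp_mono: "wp c Q s \<Longrightarrow> (\<And>k s'. Q k s' \<Longrightarrow> R k s') \<Longrightarrow> wp c R s"
  unfolding wp_def by blast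

section \<open>Frame property: arrays that a program leaves unchanged\<close>

primrec iwrites :: "com \<Rightarrow> string set" where
  "iwrites Skip = {}"
| "iwrites (IPut a e1 e2) = {a}"
| "iwrites (RPut a e1 e2) = {}"
| "iwrites (Seq c1 c2) = iwrites c1 \<union> iwrites c2"
| "iwrites (Cond b c1 c2) = iwrites c1 \<union> iwrites c2"
| "iwrites (While b c) = iwrites c"

primrec rwrites :: "com \<Rightarrow> string set" where
  "rwrites Skip = {}"
| "rwrites (IPut a e1 e2) = {}"
| "rwrites (RPut a e1 e2) = {a}"
| "rwrites (Seq c1 c2) = rwrites c1 \<union> rwrites c2"
| "rwrites (Cond b c1 c2) = rwrites c1 \<union> rwrites c2"
| "rwrites (While b c) = rwrites c"

definition frame :: "com \<Rightarrow> state \<Rightarrow> state \<Rightarrow> bool" where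
  "frame c s s' \<longleftrightarrow>
     (\<forall>a. a \<notin> iwrites c \<longrightarrow> imem s' a = imem s a) \<and> (\<forall>a. a \<notin> rwrites c \<longrightarrow> rmem s' a = rmem s a)"

lemma imem_iupdate [simp]: "imem (iupdate a j v s) = (imem s)(a := (imem s a)(j := v))"
  and rmem_iupdate [simp]: "rmem (iupdate a j v s) = rmem s"
  and imem_rupdate [simp]: "imem (rupdate a j x s) = imem s"
  and rmem_rupdate [simp]: "rmem (rupdate a j x s) = (rmem s)(a := (rmem s a)(j := x))"
  by (simp_all add: iupdate_def rupdate_def)

lemma frame_refl: "frame c s s"
  by (simp add: frame_def)

lemma runs_frame: "runs c s k s' \<Longrightarrow> frame c s s'"
  unfolding frame_def by (induction rule: runs.induct) auto

lemma wp_frame: "wp c Q s \<Longrightarrow> wp c (\<lambda>k s'. Q k s' \<and> frame c s s') s"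
  unfolding wp_def using runs_frame by blast

text \<open>The number \<open>m\<close> of rounds is fixed in advance, and \<open>m - i\<close>
  decreases. Handing \<open>frame c s s1\<close> to the premises frees \<open>Inv\<close> from
  listing arrays that the body never writes. The guard is paid \<open>m + 1\<close> times.\<close>

lemma wp_while:
  assumes start: "Inv 0 s"
    and step: "\<And>i s1. i < m \<Longrightarrow> Inv i s1 \<Longrightarrow> frame c s s1 \<Longrightarrow>
      bval b s1 \<and> wp c (\<lambda>k s2. k \<le> K \<and> Inv (Suc i) s2) s1"
    and stop: "\<And>s1. Inv m s1 \<Longrightarrow> frame c s s1 \<Longrightarrow> \<not> bval b s1"
  shows "wp (While b c)
    (\<lambda>k s1. k \<le> m * (K + 1 + bcost b) + 1 + bcost b \<and> Inv m s1 \<and> frame c s s1) s"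
proof -
  have "i \<le> m \<Longrightarrow> Inv i s1 \<Longrightarrow> frame c s s1 \<Longrightarrow>
      wp (While b c)
        (\<lambda>k s2. k \<le> (m - i) * (K + 1 + bcost b) + 1 + bcost b \<and> Inv m s2 \<and> frame c s s2) s1"
    for i s1
  proof (induction "m - i" arbitrary: i s1)
    case 0
    then have "\<not> bval b s1"
      using stop by simp
    then have "runs (While b c) s1 (1 + bcost b) s1"
      by (rule runs.WhileFalse)
    with 0 show ?case
      unfolding wp_def by (intro exI[of _ "1 + bcost b"] exI[of _ s1]) auto
  next
    case (Suc d)
    then have "i < m" and d: "d = m - Suc i" by simp_all
    then obtain k1 s2 where b: "bval b s1" and r1: "runs c s1 k1 s2" and k1: "k1 \<le> K"
      and i2: "Inv (Suc i) s2"
      using step[of i s1] Suc.prems unfolding wp_def by blast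
    have f2: "frame c s s2"
      using runs_frame[OF r1] Suc.prems(3) unfolding frame_def by auto
    obtain k2 s3 where r2: "runs (While b c) s2 k2 s3"
      and k2: "k2 \<le> (m - Suc i) * (K + 1 + bcost b) + 1 + bcost b"
      and p: "Inv m s3" "frame c s s3"
      using Suc.hyps(1)[OF d _ i2 f2] \<open>i < m\<close> unfolding wp_def by (meson Suc_leI)
    have "m - i = Suc (m - Suc i)" using \<open>i < m\<close> by simp
    then have "1 + bcost b + k1 + k2 \<le> (m - i) * (K + 1 + bcost b) + 1 + bcost b"
      using k1 k2 by simp
    then show ?case
      using runs.WhileTrue[OF b r1 r2] p unfolding wp_def by blast
  qed
  from this[of 0 s] show ?thesis using start frame_refl by simp
qed


section \<open>The program\<close>

abbreviation ivar :: "string \<Rightarrow> iexp" where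
  "ivar a \<equiv> IGet a (IConst 0)"

abbreviation rvar :: "string \<Rightarrow> rexp" where
  "rvar a \<equiv> RGet a (IConst 0)"

abbreviation iset :: "string \<Rightarrow> iexp \<Rightarrow> com" where
  "iset a e \<equiv> IPut a (IConst 0) e"

abbreviation rset :: "string \<Rightarrow> rexp \<Rightarrow> com" where
  "rset a e \<equiv> RPut a (IConst 0) e"

abbreviation seq :: "com \<Rightarrow> com \<Rightarrow> com"  (infixr ";;" 60) where
  "c ;; d \<equiv> Seq c d"

text \<open>
  Variables: \<open>m\<close> is the current cell, \<open>i\<close> its object, \<open>t\<close> its time and \<open>h\<close> its position in the
  row-by-row input; \<open>x\<close> is the current node, \<open>u\<close> the end of its layer, \<open>q\<close> the amount that taking
  the object subtracts from the code. For node \<open>x\<close>, \<open>V\<close> is its value, \<open>E\<close> the chosen bit, \<open>D\<close> the predecessor.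
\<close>

definition radix_loop :: com where
  "radix_loop = While (ILess (ivar ''j'') (IGet ''C'' (ivar ''t'')))
     (IPut ''W'' (IAdd (ivar ''t'') (IConst 1))
        (IAdd (IGet ''W'' (IAdd (ivar ''t'') (IConst 1))) (IGet ''W'' (ivar ''t''))) ;;
      iset ''j'' (IAdd (ivar ''j'') (IConst 1)))"

text \<open>Multiplication by \<open>C + 1\<close> through addition: the new entry of
  \<open>W\<close> starts as a copy of the old one, which \<open>radix_loop\<close> then adds
  \<open>C\<close> more times.\<close>

definition radices :: com where
  "radices = While (ILess (ivar ''t'') (ivar ''T''))
     (IPut ''W'' (IAdd (ivar ''t'') (IConst 1)) (IGet ''W'' (ivar ''t'')) ;;
      iset ''j'' (IConst 0) ;;
      radix_loop ;;
      iset ''t'' (IAdd (ivar ''t'') (IConst 1)))"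

text \<open>The product \<open>w * W\<^sub>t\<close> by repeated addition, cut off at \<open>(C\<^sub>t + 1) * W\<^sub>t\<close> so that the time does not depend on the size of \<open>w\<close>.\<close>

definition shift_loop :: com where
  "shift_loop = While
     (BAnd (ILess (ivar ''j'') (IGet ''w'' (ivar ''h'')))
        (BNot (ILess (IGet ''C'' (ivar ''t'')) (ivar ''j''))))
     (iset ''q'' (IAdd (ivar ''q'') (IGet ''W'' (ivar ''t''))) ;;
      iset ''j'' (IAdd (ivar ''j'') (IConst 1)))"

text \<open>Ties go to rejection, so a taking that does not fit is excluded as soon as its candidate
  \<open>r1\<close> is at most \<open>r0\<close>.\<close>

definition pick :: "iexp \<Rightarrow> rexp \<Rightarrow> rexp \<Rightarrow> com" where
  "pick e r0 r1 = Cond (RLess r0 r1)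
     (RPut ''V'' e r1 ;; IPut ''E'' e (IConst 1) ;; IPut ''D'' e (ivar ''z''))
     (RPut ''V'' e r0 ;; IPut ''E'' e (IConst 0) ;; IPut ''D'' e (ivar ''y''))"

text \<open>
  If the object does not fit, \<open>d = a - B\<close> makes both comparisons in \<open>pick\<close> fail, because \<open>B \<ge> 0\<close>.
  At the last time step \<open>B\<close> is read beyond the end of its array, where the input memory holds 0.
\<close>

definition node_pair :: com where
  "node_pair =
     iset ''y'' (ISub (ivar ''x'') (ivar ''L'')) ;;
     rset ''a'' (RGet ''V'' (ivar ''y'')) ;;
     Cond (ILess (ivar ''r'') (ivar ''q''))
       (iset ''z'' (ivar ''y'') ;;
        rset ''d'' (RSub (rvar ''a'') (RGet ''B'' (ivar ''h''))))
       (iset ''z'' (IAdd (ISub (ivar ''y'') (ivar ''q'')) (IConst 1)) ;;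
        rset ''d'' (RAdd (RGet ''V'' (ivar ''z'')) (RGet ''p'' (ivar ''h'')))) ;;
     pick (ivar ''x'') (RAdd (rvar ''a'') (RGet ''B'' (ivar ''h''))) (rvar ''d'') ;;
     pick (IAdd (ivar ''x'') (IConst 1)) (rvar ''a'')
       (RAdd (rvar ''d'') (RGet ''B'' (ivar ''h''))) ;;
     iset ''x'' (IAdd (ivar ''x'') (IConst 2)) ;;
     iset ''r'' (IAdd (ivar ''r'') (IConst 2)) ;;
     Cond (ILess (ivar ''r'') (IGet ''W'' (IAdd (ivar ''t'') (IConst 1))))
       Skip (iset ''r'' (IConst 0))"

definition layer_loop :: com where
  "layer_loop = While (ILess (ivar ''x'') (ivar ''u'')) node_pair"

text \<open>\<open>H\<close> records where each cell sits in the input, so the traceback finds the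
  output position without inverting the cell numbering.\<close>

definition layers :: com where
  "layers = While (ILess (ivar ''i'') (ivar ''n''))
     (IPut ''H'' (ivar ''m'') (ivar ''h'') ;;
      iset ''q'' (IConst 0) ;;
      iset ''j'' (IConst 0) ;;
      shift_loop ;;
      iset ''r'' (IConst 0) ;;
      iset ''u'' (IAdd (ivar ''u'') (ivar ''L'')) ;;
      layer_loop ;;
      iset ''m'' (IAdd (ivar ''m'') (IConst 1)) ;;
      iset ''t'' (IAdd (ivar ''t'') (IConst 1)) ;;
      iset ''h'' (IAdd (ivar ''h'') (ivar ''n'')) ;;
      Cond (ILess (ivar ''t'') (ivar ''T'')) Skip
        (iset ''t'' (IConst 0) ;;
         iset ''i'' (IAdd (ivar ''i'') (IConst 1)) ;;
         iset ''h'' (ivar ''i'')))"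

definition traceback :: com where
  "traceback = While (ILess (IConst 0) (ivar ''m''))
     (iset ''m'' (ISub (ivar ''m'') (IConst 1)) ;;
      IPut ''S'' (IGet ''H'' (ivar ''m'')) (IGet ''E'' (ivar ''x'')) ;;
      iset ''x'' (IGet ''D'' (ivar ''x'')))"

text \<open>Layer 0 consists of the nodes below \<open>L\<close> and is never written: the zeros of
  the initial memory are its values. After the last layer, \<open>x - 2\<close> is the node with
  full capacities and bit 0.\<close>

definition knapsack_program :: com where
  "knapsack_program =
     IPut ''W'' (IConst 0) (IConst 2) ;;
     radices ;;
     iset ''L'' (IGet ''W'' (ivar ''T'')) ;;
     iset ''x'' (ivar ''L'') ;;
     iset ''u'' (ivar ''L'') ;;
     iset ''t'' (IConst 0) ;;
     layers ;;
     iset ''x'' (ISub (ivar ''x'') (IConst 2)) ;;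
     traceback"

section \<open>The transition at one pair of nodes\<close>

definition picked :: "state \<Rightarrow> int \<Rightarrow> real \<Rightarrow> real \<Rightarrow> state" where
  "picked s x v0 v1 =
     iupdate ''D'' x (if v0 < v1 then imem s ''z'' 0 else imem s ''y'' 0)
       (iupdate ''E'' x (if v0 < v1 then 1 else 0) (rupdate ''V'' x (max v0 v1) s))"

lemma imem_picked [simp]: "imem (picked s x v0 v1) = (imem s)
    (''E'' := (imem s ''E'')(x := if v0 < v1 then 1 else 0),
     ''D'' := (imem s ''D'')(x := if v0 < v1 then imem s ''z'' 0 else imem s ''y'' 0))"
  and rmem_picked [simp]: "rmem (picked s x v0 v1) = (rmem s)(''V'' := (rmem s ''V'')(x := max v0 v1))"
  by (auto simp: picked_def fun_eq_iff)

text \<open>\<open>e\<close> is evaluated again after each write, hence the premises that writing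
  \<open>V\<close> and \<open>E\<close> preserves its value.\<close>

lemma wp_pick:
  assumes "\<And>f. ival e (rupdate ''V'' (ival e s) f s) = ival e s"
    "\<And>f g. ival e (iupdate ''E'' (ival e s) f (rupdate ''V'' (ival e s) g s)) = ival e s"
    "\<And>k. k \<le> 20 + 3 * icost e + 2 * (rcost r0 + rcost r1) \<Longrightarrow> Q k (picked s (ival e s) (rval r0 s) (rval r1 s))"
  shows "wp (pick e r0 r1) Q s"
proof (cases "rval r0 s < rval r1 s")
  case True
  show ?thesis using assms(1,2) assms(3)[unfolded picked_def] True by (simp add: pick_def max_def)
next
  case False
  show ?thesis using assms(1,2) assms(3)[unfolded picked_def] False
    by (simp add: pick_def max_def not_less order.antisym)
qed

text \<open>
  Node \<open>x\<close>, whose following cell has choice \<open>b\<close>, attains and dominates the values obtained through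
  its predecessors \<open>y\<close> (object rejected) and \<open>z\<close> (object taken).
\<close>

definition node_ok ::
    "(int \<Rightarrow> real) \<Rightarrow> (int \<Rightarrow> int) \<Rightarrow> (int \<Rightarrow> int) \<Rightarrow> bool \<Rightarrow> real \<Rightarrow> real \<Rightarrow> int \<Rightarrow> int \<Rightarrow> int \<Rightarrow> int \<Rightarrow> bool"
  where
  "node_ok V E D feas p \<beta> y z x b \<longleftrightarrow>
     (E x = 0 \<and> D x = y \<or> feas \<and> E x = 1 \<and> D x = z) \<and>
     V x = V (D x) + (if E x = 1 then p else 0) + (if E x = b then \<beta> else 0) \<and>
     V y + (if b = 0 then \<beta> else 0) \<le> V x \<and>
     (feas \<longrightarrow> V z + p + (if b = 1 then \<beta> else 0) \<le> V x)"

lemma node_ok_cong: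
  assumes "V' x = V x" "E' x = E x" "D' x = D x" "V' y = V y" "feas \<Longrightarrow> V' z = V z"
  shows "node_ok V' E' D' feas p \<beta> y z x b = node_ok V E D feas p \<beta> y z x b"
  using assms unfolding node_ok_def by auto

lemma node_ok_max:
  assumes "V x = max v0 v1" "E x = (if v0 < v1 then 1 else 0)" "D x = (if v0 < v1 then z else y)"
    "v0 = V y + (if b = 0 then \<beta> else 0)" "feas \<Longrightarrow> v1 = V z + p + (if b = 1 then \<beta> else 0)"
    "\<not> feas \<Longrightarrow> v1 \<le> v0" "b = 0 \<or> b = 1"
  shows "node_ok V E D feas p \<beta> y z x b"
  using assms unfolding node_ok_def by (cases feas) (auto simp: max_def)

text \<open>Nodes \<open>x\<close> and \<open>x + 1\<close> share the capacities and differ in the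
  bit, so the candidates \<open>a\<close> (reject) and \<open>d\<close> (take) serve both. The bonus
  goes to the candidate agreeing with the bit: rejection at \<open>x\<close>, taking at
  \<open>x + 1\<close>.\<close>

lemma node_pair_effect:
  assumes "y = x - L" "z = (if r < q then y else y - q + 1)" "a = rmem s ''V'' y"
    "d = (if r < q then a - \<beta> else rmem s ''V'' z + p)"
    "imem s ''x'' 0 = x" "imem s ''L'' 0 = L" "imem s ''q'' 0 = q" "imem s ''r'' 0 = r"
    "imem s ''W'' (imem s ''t'' 0 + 1) = W" "rmem s ''p'' (imem s ''h'' 0) = p"
    "rmem s ''B'' (imem s ''h'' 0) = \<beta>"
  shows "wp node_pair (\<lambda>k s'. k \<le> 200 \<and> imem s' ''x'' 0 = x + 2 \<and>
      imem s' ''r'' 0 = (if r + 2 < W then r + 2 else 0) \<and>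
      rmem s' ''V'' = (rmem s ''V'')(x := max (a + \<beta>) d, x + 1 := max a (d + \<beta>)) \<and>
      imem s' ''E'' = (imem s ''E'')(x := if a + \<beta> < d then 1 else 0, x + 1 := if a < d + \<beta> then 1 else 0) \<and>
      imem s' ''D'' = (imem s ''D'')(x := if a + \<beta> < d then z else y, x + 1 := if a < d + \<beta> then z else y)) s"
  unfolding node_pair_def
  by (insert assms; cases "r < q"; cases "r + 2 < W"; simp split del: if_split;
    rule wp_pick; simp split del: if_split; rule wp_pick; simp split del: if_split cong: if_cong)

lemma node_pair_spec:
  assumes "imem s ''x'' 0 = x" "imem s ''L'' 0 = L" "imem s ''q'' 0 = q" "imem s ''r'' 0 = r"
    "imem s ''W'' (imem s ''t'' 0 + 1) = W" "rmem s ''p'' (imem s ''h'' 0) = p"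
    "rmem s ''B'' (imem s ''h'' 0) = \<beta>" and pos: "\<beta> \<ge> 0" "q \<ge> 0" "L \<ge> 2"
  shows "wp node_pair (\<lambda>k s'. k \<le> 200 \<and> imem s' ''x'' 0 = x + 2 \<and>
      imem s' ''r'' 0 = (if r + 2 < W then r + 2 else 0) \<and>
      (\<forall>x'<x. rmem s' ''V'' x' = rmem s ''V'' x' \<and> imem s' ''E'' x' = imem s ''E'' x' \<and>
         imem s' ''D'' x' = imem s ''D'' x') \<and>
      (\<forall>b\<in>{0,1}. node_ok (rmem s' ''V'') (imem s' ''E'') (imem s' ''D'') (q \<le> r) p \<beta>
         (x - L) (x - L - q + 1) (x + b) b)) s"
proof -
  define y where "y = x - L"
  define z where "z = (if r < q then y else y - q + 1)"
  define a where "a = rmem s ''V'' y"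
  define d where "d = (if r < q then a - \<beta> else rmem s ''V'' z + p)"
  \<comment> \<open>Both predecessors lie below \<open>x\<close>, so the writes at \<open>x\<close>
    and \<open>x + 1\<close> do not alter their values; \<open>L \<ge> 2\<close> absorbs the
    \<open>+ 1\<close> in \<open>z\<close>.\<close>
  have yz: "y < x" "z < x"
    using pos by (auto simp: y_def z_def)
  show ?thesis
  proof (rule wp_mono[OF node_pair_effect[OF y_def z_def a_def d_def assms(1-7)]],
      elim conjE, intro conjI ballI)
    fix k s' and b :: int
    assume V: "rmem s' ''V'' = (rmem s ''V'')(x := max (a + \<beta>) d, x + 1 := max a (d + \<beta>))"
      and E: "imem s' ''E'' = (imem s ''E'')
        (x := if a + \<beta> < d then 1 else 0, x + 1 := if a < d + \<beta> then 1 else 0)"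
      and D: "imem s' ''D'' = (imem s ''D'')
        (x := if a + \<beta> < d then z else y, x + 1 := if a < d + \<beta> then z else y)"
      and b: "b \<in> {0, 1}"
    have "node_ok (rmem s' ''V'') (imem s' ''E'') (imem s' ''D'') (q \<le> r) p \<beta> y z (x + b) b"
    proof (rule node_ok_max)
      show "rmem s' ''V'' (x + b) = max (if b = 0 then a + \<beta> else a) (if b = 0 then d else d + \<beta>)"
        using b by (auto simp: V)
    qed (use b yz pos in \<open>auto simp: V E D a_def d_def not_less\<close>)
    then show "node_ok (rmem s' ''V'') (imem s' ''E'') (imem s' ''D'') (q \<le> r) p \<beta>
         (x - L) (x - L - q + 1) (x + b) b"
      by (auto simp: y_def z_def node_ok_def)
  qed auto
qed

lemma frame_imem: "frame c s s' \<Longrightarrow> a \<notin> iwrites c \<Longrightarrow> imem s' a = imem s a"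
  and frame_rmem: "frame c s s' \<Longrightarrow> a \<notin> rwrites c \<Longrightarrow> rmem s' a = rmem s a"
  by (simp_all add: frame_def)

lemma writes_node_pair [simp]:
  "iwrites node_pair = {''y'', ''z'', ''E'', ''D'', ''x'', ''r''}"
  "rwrites node_pair = {''a'', ''d'', ''V''}"
  by (auto simp: node_pair_def pick_def)

lemma writes_loops [simp]:
  "iwrites radix_loop = {''W'', ''j''}" "rwrites radix_loop = {}"
  "iwrites radices = {''W'', ''j'', ''t''}" "rwrites radices = {}"
  "iwrites shift_loop = {''q'', ''j''}" "rwrites shift_loop = {}"
  "iwrites layer_loop = iwrites node_pair" "rwrites layer_loop = rwrites node_pair"
  by (auto simp: radix_loop_def radices_def shift_loop_def layer_loop_def)

section \<open>Invariants and costs of the loops\<close>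

lemma radix_loop_spec:
  assumes "imem s ''t'' 0 = t" "imem s ''W'' t = v" "imem s ''W'' (t + 1) = v" "imem s ''j'' 0 = 0"
    "imem s ''C'' t = int c"
  shows "wp radix_loop (\<lambda>k s'. k \<le> 30 * (c + 1) \<and>
    imem s' ''W'' = (imem s ''W'')(t + 1 := v * (int c + 1)) \<and> frame radix_loop s s') s"
proof -
  define body where "body =
     (IPut ''W'' (IAdd (ivar ''t'') (IConst 1))
        (IAdd (IGet ''W'' (IAdd (ivar ''t'') (IConst 1))) (IGet ''W'' (ivar ''t''))) ;;
      iset ''j'' (IAdd (ivar ''j'') (IConst 1)))"
  let ?Inv = "\<lambda>i s1. imem s1 ''j'' 0 = int i \<and>
    imem s1 ''W'' = (imem s ''W'')(t + 1 := v * (int i + 1))"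
  have "wp radix_loop (\<lambda>k s'. (k \<le> c * (20 + 1 + 6) + 1 + 6 \<and> ?Inv c s') \<and> frame radix_loop s s') s"
    unfolding radix_loop_def body_def[symmetric]
  proof (rule wp_frame[OF wp_mono[OF wp_while[where Inv = ?Inv and K = 20 and m = c]]])
    show "?Inv 0 s" using assms by auto
  next
    fix i s1
    assume i: "i < c" and inv: "?Inv i s1" and f: "frame body s s1"
    show "bval (ILess (ivar ''j'') (IGet ''C'' (ivar ''t''))) s1 \<and>
      wp body (\<lambda>k s2. k \<le> 20 \<and> ?Inv (Suc i) s2) s1"
      using assms i inv by (simp add: frame_imem[OF f] body_def algebra_simps)
  next
    fix s1
    assume inv: "?Inv c s1" and f: "frame body s s1"
    show "\<not> bval (ILess (ivar ''j'') (IGet ''C'' (ivar ''t''))) s1"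
      using assms inv by (simp add: frame_imem[OF f] body_def)
  qed simp
  then show ?thesis
    by (rule wp_mono) auto
qed

text \<open>Place values of the mixed-radix system whose digit \<open>t\<close> ranges over
  \<open>0..C t\<close>; the factor 2 reserves the parity for the choice bit.\<close>

definition radix :: "(nat \<Rightarrow> nat) \<Rightarrow> nat \<Rightarrow> int" where
  "radix C t = 2 * (\<Prod>u<t. int (C u) + 1)"

lemma radix_Suc: "radix C (Suc t) = radix C t * (int (C t) + 1)"
  and radix_0 [simp]: "radix C 0 = 2"
  by (simp_all add: radix_def)

lemma radices_spec:
  assumes "imem s ''t'' 0 = 0" "imem s ''T'' 0 = int T" "imem s ''W'' 0 = 2"
    and C: "\<And>t. t < T \<Longrightarrow> imem s ''C'' (int t) = int (C t) \<and> C t + 1 \<le> M"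
  shows "wp radices (\<lambda>k s'. k \<le> T * (30 * M + 50) + 10 \<and>
    (\<forall>t\<le>T. imem s' ''W'' (int t) = radix C t) \<and> frame radices s s') s"
proof -
  define body where "body =
     (IPut ''W'' (IAdd (ivar ''t'') (IConst 1)) (IGet ''W'' (ivar ''t'')) ;;
      iset ''j'' (IConst 0) ;;
      radix_loop ;;
      iset ''t'' (IAdd (ivar ''t'') (IConst 1)))"
  let ?Inv = "\<lambda>i s1. imem s1 ''t'' 0 = int i \<and> (\<forall>t\<le>i. imem s1 ''W'' (int t) = radix C t)"
  have "wp radices (\<lambda>k s'. (k \<le> T * ((30 * M + 30) + 1 + 5) + 1 + 5 \<and> ?Inv T s') \<and> frame radices s s') s"
    unfolding radices_def body_def[symmetric]
  proof (rule wp_frame[OF wp_mono[OF wp_while[where Inv = ?Inv and K = "30 * M + 30" and m = T]]])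
    show "?Inv 0 s" using assms by auto
  next
    fix i s1
    assume i: "i < T" and inv: "?Inv i s1" and f: "frame body s s1"
    have w: "iwrites body = {''W'', ''j'', ''t''}"
      by (auto simp: body_def)
    have "wp body (\<lambda>k s2. k \<le> 30 * M + 30 \<and> ?Inv (Suc i) s2) s1"
      unfolding body_def
      by (insert inv C[OF i], simp, rule wp_mono[OF radix_loop_spec])
        (auto simp: frame_imem[OF f] w frame_imem[of radix_loop] radix_Suc le_Suc_eq)
    then show "bval (ILess (ivar ''t'') (ivar ''T'')) s1 \<and>
      wp body (\<lambda>k s2. k \<le> 30 * M + 30 \<and> ?Inv (Suc i) s2) s1"
      using assms i inv by (simp add: frame_imem[OF f] w)
  next
    fix s1
    assume inv: "?Inv T s1" and f: "frame body s s1"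
    then show "\<not> bval (ILess (ivar ''t'') (ivar ''T'')) s1"
      using assms by (simp add: frame_imem[OF f] body_def)
  qed simp
  then show ?thesis
    by (rule wp_mono) (auto simp: algebra_simps)
qed

lemma shift_loop_spec:
  assumes "imem s ''t'' 0 = t" "imem s ''W'' t = v" "imem s ''q'' 0 = 0" "imem s ''j'' 0 = 0"
    "imem s ''C'' t = int c" "imem s ''w'' (imem s ''h'' 0) = int w"
  shows "wp shift_loop (\<lambda>k s'. k \<le> 40 * (c + 2) \<and>
    imem s' ''q'' 0 = int (min w (c + 1)) * v \<and> frame shift_loop s s') s"
proof -
  define body where "body =
     (iset ''q'' (IAdd (ivar ''q'') (IGet ''W'' (ivar ''t''))) ;;
      iset ''j'' (IAdd (ivar ''j'') (IConst 1)))"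
  \<comment> \<open>The guard fails once \<open>j\<close> reaches the weight or exceeds
    \<open>c\<close>, which fixes the number of rounds.\<close>
  define m where "m = min w (c + 1)"
  have "m \<le> c + 1" by (simp add: m_def)
  let ?Inv = "\<lambda>i s1. imem s1 ''j'' 0 = int i \<and> imem s1 ''q'' 0 = int i * v"
  have "wp shift_loop (\<lambda>k s'. (k \<le> m * (20 + 1 + 14) + 1 + 14 \<and> ?Inv m s') \<and> frame shift_loop s s') s"
    unfolding shift_loop_def body_def[symmetric]
  proof (rule wp_frame[OF wp_mono[OF wp_while[where Inv = ?Inv and K = 20 and m = m]]])
    show "?Inv 0 s" using assms by auto
  next
    fix i s1
    assume i: "i < m" and inv: "?Inv i s1" and f: "frame body s s1"
    show "bval (BAnd (ILess (ivar ''j'') (IGet ''w'' (ivar ''h'')))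
        (BNot (ILess (IGet ''C'' (ivar ''t'')) (ivar ''j'')))) s1 \<and>
      wp body (\<lambda>k s2. k \<le> 20 \<and> ?Inv (Suc i) s2) s1"
      using assms i inv by (auto simp: frame_imem[OF f] body_def m_def algebra_simps)
  next
    fix s1
    assume inv: "?Inv m s1" and f: "frame body s s1"
    then show "\<not> bval (BAnd (ILess (ivar ''j'') (IGet ''w'' (ivar ''h'')))
        (BNot (ILess (IGet ''C'' (ivar ''t'')) (ivar ''j'')))) s1"
      using assms by (auto simp: frame_imem[OF f] body_def m_def)
  qed simp
  then show ?thesis
    by (rule wp_mono) (use \<open>m \<le> c + 1\<close> in \<open>auto simp: m_def[simplified, symmetric]\<close>)
qed

text \<open>The machine keeps \<open>r = e mod W\<close> as a counter; evenness of \<open>W\<close> makes it wrap around exactly.\<close>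

lemma layer_loop_spec:
  assumes "imem s ''x'' 0 = x" "imem s ''u'' 0 = x + L" "imem s ''L'' 0 = L" "imem s ''q'' 0 = q"
    "imem s ''r'' 0 = 0" "imem s ''W'' (imem s ''t'' 0 + 1) = W" "rmem s ''p'' (imem s ''h'' 0) = p"
    "rmem s ''B'' (imem s ''h'' 0) = \<beta>"
    and pos: "\<beta> \<ge> 0" "q \<ge> 0" "L \<ge> 2" "even L" "even W" "W \<ge> 2"
  shows "wp layer_loop (\<lambda>k s'. k \<le> 150 * nat L \<and> imem s' ''x'' 0 = x + L \<and>
      (\<forall>x'<x. rmem s' ''V'' x' = rmem s ''V'' x' \<and> imem s' ''E'' x' = imem s ''E'' x' \<and>
         imem s' ''D'' x' = imem s ''D'' x') \<and>
      (\<forall>e b. even e \<and> 0 \<le> e \<and> e < L \<and> (b = 0 \<or> b = 1) \<longrightarrow>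
         node_ok (rmem s' ''V'') (imem s' ''E'') (imem s' ''D'') (q \<le> e mod W) p \<beta>
           (x - L + e) (x - L + e - q + 1) (x + e + b) b) \<and> frame layer_loop s s') s"
proof -
  \<comment> \<open>Each round handles two nodes, and \<open>L\<close> is even.\<close>
  define m where "m = nat (L div 2)"
  have L: "L = 2 * int m"
    using pos by (auto simp: m_def)
  let ?ok = "\<lambda>s' e b. node_ok (rmem s' ''V'') (imem s' ''E'') (imem s' ''D'') (q \<le> e mod W) p \<beta>
           (x - L + e) (x - L + e - q + 1) (x + e + b) b"
  let ?Inv = "\<lambda>i s'. imem s' ''x'' 0 = x + 2 * int i \<and> imem s' ''r'' 0 = (2 * int i) mod W \<and>
      (\<forall>x'<x. rmem s' ''V'' x' = rmem s ''V'' x' \<and> imem s' ''E'' x' = imem s ''E'' x' \<and>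
         imem s' ''D'' x' = imem s ''D'' x') \<and>
      (\<forall>e b. even e \<and> 0 \<le> e \<and> e < 2 * int i \<and> (b = 0 \<or> b = 1) \<longrightarrow> ?ok s' e b)"
  have "wp layer_loop (\<lambda>k s'. (k \<le> m * (200 + 1 + 6) + 1 + 6 \<and> ?Inv m s') \<and> frame layer_loop s s') s"
    unfolding layer_loop_def
  proof (rule wp_frame[OF wp_mono[OF wp_while[where Inv = ?Inv and K = 200 and m = m]]])
    show "?Inv 0 s" using assms by auto
  next
    fix i s1
    assume i: "i < m" and inv: "?Inv i s1" and f: "frame node_pair s s1"
    have mod: "(if (2 * int i) mod W + 2 < W then (2 * int i) mod W + 2 else 0) = (2 * int (Suc i)) mod W"
    proof -
      let ?r = "(2 * int i) mod W"
      have "even ?r" "0 \<le> ?r" "?r < W" using pos by (auto simp: dvd_mod)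
      moreover have "even r \<Longrightarrow> r < W \<Longrightarrow> r + 2 \<le> W" for r
        using pos by presburger
      ultimately have "?r + 2 \<le> W" by blast
      moreover have "(2 * int (Suc i)) mod W = (?r + 2) mod W"
        by (simp add: mod_simps algebra_simps)
      ultimately show ?thesis using \<open>0 \<le> ?r\<close> by auto
    qed
    have "wp node_pair (\<lambda>k s2. k \<le> 200 \<and> ?Inv (Suc i) s2) s1"
    proof (rule wp_mono[OF node_pair_spec[where x = "x + 2 * int i" and L = L and q = q
            and r = "(2 * int i) mod W" and W = W and p = p and \<beta> = \<beta>]])
      fix k s2
      assume a: "k \<le> 200 \<and> imem s2 ''x'' 0 = x + 2 * int i + 2 \<and>
        imem s2 ''r'' 0 = (if (2 * int i) mod W + 2 < W then (2 * int i) mod W + 2 else 0) \<and>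
        (\<forall>x'<x + 2 * int i. rmem s2 ''V'' x' = rmem s1 ''V'' x' \<and> imem s2 ''E'' x' = imem s1 ''E'' x' \<and>
           imem s2 ''D'' x' = imem s1 ''D'' x') \<and>
        (\<forall>b\<in>{0,1}. node_ok (rmem s2 ''V'') (imem s2 ''E'') (imem s2 ''D'') (q \<le> (2 * int i) mod W) p \<beta>
           (x + 2 * int i - L) (x + 2 * int i - L - q + 1) (x + 2 * int i + b) b)"
      have "?ok s2 e b" if e: "even e" "0 \<le> e" "e < 2 * int (Suc i)" "b = 0 \<or> b = 1" for e b
      proof (cases "e = 2 * int i")
        case True
        have "x - L + e = x + 2 * int i - L" "x + e + b = x + 2 * int i + b"
          using True by auto
        then show ?thesis using a e(4) True by (metis insert_iff)
      next
        case False
        then have e2: "e < 2 * int i" using e by presburger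
        \<comment> \<open>Parity keeps both nodes of an earlier pair below the pair just written, so
          they and their predecessors carry over.\<close>
        then have "e + 1 < 2 * int i" using e by presburger
        moreover have "?ok s1 e b" using inv e e2 by auto
        ultimately show ?thesis
          by (subst node_ok_cong[where V = "rmem s1 ''V''" and E = "imem s1 ''E''" and D = "imem s1 ''D''"])
            (use a e pos in auto)
      qed
      then show "k \<le> 200 \<and> ?Inv (Suc i) s2"
        using a inv mod by auto
    qed (use assms inv in \<open>auto simp: frame_imem[OF f] frame_rmem[OF f]\<close>)
    then show "bval (ILess (ivar ''x'') (ivar ''u'')) s1 \<and> wp node_pair (\<lambda>k s2. k \<le> 200 \<and> ?Inv (Suc i) s2) s1"
      using assms i inv L by (simp add: frame_imem[OF f])
  next
    fix s1
    assume inv: "?Inv m s1" and f: "frame node_pair s s1"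
    then show "\<not> bval (ILess (ivar ''x'') (ivar ''u'')) s1"
      using assms L by (simp add: frame_imem[OF f])
  qed simp
  moreover have "m * (200 + 1 + 6) + 1 + 6 \<le> 150 * nat L"
    using L pos by simp
  ultimately show ?thesis
    by (elim wp_mono) (auto simp: L)
qed

section \<open>Layers of the dynamic program\<close>

lemma even_radix [simp]: "even (radix C t)"
  and radix_ge_2: "radix C t \<ge> 2"
proof -
  have "(\<Prod>u<t. int (C u) + 1) \<ge> 1"
    by (rule prod_ge_1) simp
  then show "radix C t \<ge> 2" by (simp add: radix_def)
qed (simp add: radix_def)

lemma even_add_1_less: "even (a::int) \<Longrightarrow> even b \<Longrightarrow> a < b \<Longrightarrow> a + 1 < b"
  by presburger

text \<open>\<open>wt\<close>, \<open>pf\<close> and \<open>bn\<close> are indexed by cells \<open>j = i * T + t\<close>; times and objects count from 0.\<close>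

locale knapsack_chain =
  fixes T n :: nat and C wt :: "nat \<Rightarrow> nat" and pf bn :: "nat \<Rightarrow> real"
  assumes T: "T \<ge> 1" and bn_nonneg: "\<And>j. bn j \<ge> 0"
begin

definition L :: int where
  "L = radix C T"

text \<open>Cell \<open>j\<close> is object \<open>j div T\<close> at time \<open>j mod T\<close>;
  the input has one row of \<open>n\<close> entries per time.\<close>

definition cell_pos :: "nat \<Rightarrow> nat" where
  "cell_pos j = (j mod T) * n + j div T"

definition shift :: "nat \<Rightarrow> int" where
  "shift j = int (min (wt j) (C (j mod T) + 1)) * radix C (j mod T)"

text \<open>The residue discards the digits of later times, and the digits of earlier times are too
  small to matter, so a single digit is tested; see \<open>fits_enc\<close>.\<close>

definition fits :: "nat \<Rightarrow> int \<Rightarrow> bool" where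
  "fits j e \<longleftrightarrow> shift j \<le> e mod radix C (Suc (j mod T))"

text \<open>Cell \<open>j\<close> is the transition from layer \<open>j\<close>, which starts at
  node \<open>int j * L\<close>, to the next layer. The bit of a predecessor is the choice made in
  cell \<open>j\<close>: 0 for rejection and 1, hence the \<open>+ 1\<close>, for taking.\<close>

definition cell_ok :: "(int \<Rightarrow> real) \<Rightarrow> (int \<Rightarrow> int) \<Rightarrow> (int \<Rightarrow> int) \<Rightarrow> nat \<Rightarrow> bool" where
  "cell_ok V E D j \<longleftrightarrow> (\<forall>e b. even e \<and> 0 \<le> e \<and> e < L \<and> (b = 0 \<or> b = 1) \<longrightarrow>
     node_ok V E D (fits j e) (pf j) (bn j) (int j * L + e) (int j * L + e - shift j + 1)
       (int (Suc j) * L + e + b) b)"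

lemma L_pos: "L \<ge> 2" "even L"
  by (simp_all add: L_def radix_ge_2)

lemma shift_nonneg: "shift j \<ge> 0"
  using radix_ge_2[of C "j mod T"] by (simp add: shift_def)

text \<open>A cell refers only to nodes below the end of layer \<open>j + 1\<close>, so filling
  later layers cannot spoil it.\<close>

lemma cell_ok_cong:
  assumes "\<And>x. x < int (j + 2) * L \<Longrightarrow> V' x = V x \<and> E' x = E x \<and> D' x = D x"
  shows "cell_ok V' E' D' j = cell_ok V E D j"
proof -
  have "node_ok V' E' D' (fits j e) (pf j) (bn j) (int j * L + e) (int j * L + e - shift j + 1)
       (int (Suc j) * L + e + b) b =
     node_ok V E D (fits j e) (pf j) (bn j) (int j * L + e) (int j * L + e - shift j + 1)
       (int (Suc j) * L + e + b) b"
    if e: "even e" "0 \<le> e" "e < L" "b = 0 \<or> b = 1" for e b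
  proof -
    have "e + 1 < L" using e L_pos even_add_1_less by blast
    then show ?thesis using e L_pos shift_nonneg[of j]
      by (intro node_ok_cong) (auto simp: assms algebra_simps)
  qed
  then show ?thesis unfolding cell_ok_def by blast
qed

lemma layers_spec:
  assumes init: "imem s ''T'' 0 = int T" "imem s ''n'' 0 = int n" "imem s ''x'' 0 = L"
      "imem s ''u'' 0 = L" "imem s ''L'' 0 = L" "imem s ''t'' 0 = 0" "imem s ''i'' 0 = 0"
      "imem s ''h'' 0 = 0" "imem s ''m'' 0 = 0"
    and W: "\<And>t. t \<le> T \<Longrightarrow> imem s ''W'' (int t) = radix C t"
    and C: "\<And>t. t < T \<Longrightarrow> imem s ''C'' (int t) = int (C t) \<and> C t + 1 \<le> M"
    and cells: "\<And>j. j < n * T \<Longrightarrow> imem s ''w'' (int (cell_pos j)) = int (wt j) \<and>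
      rmem s ''p'' (int (cell_pos j)) = pf j \<and> rmem s ''B'' (int (cell_pos j)) = bn j"
    and V: "\<And>x. rmem s ''V'' x = 0"
  shows "wp layers (\<lambda>k s'. k \<le> n * T * (40 * (M + 1) + 150 * nat L + 100) + 10 \<and>
      imem s' ''m'' 0 = int (n * T) \<and> imem s' ''x'' 0 = int (n * T + 1) * L \<and>
      (\<forall>j<n * T. imem s' ''H'' (int j) = int (cell_pos j) \<and>
         cell_ok (rmem s' ''V'') (imem s' ''E'') (imem s' ''D'') j) \<and>
      (\<forall>x<L. rmem s' ''V'' x = 0)) s"
proof -
  define body where "body =
     (IPut ''H'' (ivar ''m'') (ivar ''h'') ;;
      iset ''q'' (IConst 0) ;;
      iset ''j'' (IConst 0) ;;
      shift_loop ;;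
      iset ''r'' (IConst 0) ;;
      iset ''u'' (IAdd (ivar ''u'') (ivar ''L'')) ;;
      layer_loop ;;
      iset ''m'' (IAdd (ivar ''m'') (IConst 1)) ;;
      iset ''t'' (IAdd (ivar ''t'') (IConst 1)) ;;
      iset ''h'' (IAdd (ivar ''h'') (ivar ''n'')) ;;
      Cond (ILess (ivar ''t'') (ivar ''T'')) Skip
        (iset ''t'' (IConst 0) ;;
         iset ''i'' (IAdd (ivar ''i'') (IConst 1)) ;;
         iset ''h'' (ivar ''i'')))"
  have writes: "iwrites body = {''H'', ''q'', ''j'', ''r'', ''u'', ''y'', ''z'', ''E'', ''D'', ''x'', ''m'', ''t'', ''h'', ''i''}"
    "rwrites body = {''a'', ''d'', ''V''}"
    by (auto simp: body_def)
  define K where "K = 40 * (M + 1) + 150 * nat L + 90"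
  \<comment> \<open>Between rounds \<open>x\<close> and \<open>u\<close> agree: layer
    \<open>j\<close> is complete and layer \<open>j + 1\<close> starts there.\<close>
  define Inv where "Inv j s' \<longleftrightarrow> imem s' ''m'' 0 = int j \<and> imem s' ''t'' 0 = int (j mod T) \<and>
      imem s' ''i'' 0 = int (j div T) \<and> imem s' ''h'' 0 = int (cell_pos j) \<and>
      imem s' ''x'' 0 = int (Suc j) * L \<and> imem s' ''u'' 0 = int (Suc j) * L \<and>
      (\<forall>j'<j. imem s' ''H'' (int j') = int (cell_pos j')) \<and>
      (\<forall>j'<j. cell_ok (rmem s' ''V'') (imem s' ''E'') (imem s' ''D'') j') \<and>
      (\<forall>x<L. rmem s' ''V'' x = 0)" for j and s' :: state
  have "wp layers (\<lambda>k s'. k \<le> n * T * (K + 1 + 5) + 1 + 5 \<and> Inv (n * T) s') s"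
    unfolding layers_def body_def[symmetric]
  proof (rule wp_mono[OF wp_while[where Inv = Inv and K = K and m = "n * T"]])
    show "Inv 0 s" using assms by (auto simp: Inv_def cell_pos_def)
  next
    fix j s1
    assume j: "j < n * T" and inv: "Inv j s1" and f: "frame body s s1"
    have jt: "j mod T < T" using T by simp
    define X where "X = int (Suc j) * L"
    have X: "int (Suc (Suc j)) * L = X + L" "int (Suc j) * L = X" "int j * L = X - L"
      by (simp_all add: X_def algebra_simps)
    have jT: "j div T < n"
      using j by (simp add: less_mult_imp_div_less)
    have inv1: "imem s1 ''m'' 0 = int j" "imem s1 ''t'' 0 = int (j mod T)"
      "imem s1 ''i'' 0 = int (j div T)" "imem s1 ''h'' 0 = int (cell_pos j)"
      "imem s1 ''x'' 0 = X" "imem s1 ''u'' 0 = X"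
      and inv2: "\<forall>j'<j. imem s1 ''H'' (int j') = int (cell_pos j')"
      "\<forall>j'<j. cell_ok (rmem s1 ''V'') (imem s1 ''E'') (imem s1 ''D'') j'"
      "\<forall>x<L. rmem s1 ''V'' x = 0"
      using inv by (auto simp: Inv_def X_def)
    have const: "imem s1 ''T'' 0 = int T" "imem s1 ''n'' 0 = int n" "imem s1 ''L'' 0 = L"
      "imem s1 ''W'' (int (j mod T)) = radix C (j mod T)"
      "imem s1 ''W'' (int (j mod T) + 1) = radix C (Suc (j mod T))"
      "imem s1 ''C'' (int (j mod T)) = int (C (j mod T))"
      "imem s1 ''w'' (int (cell_pos j)) = int (wt j)"
      "rmem s1 ''p'' (int (cell_pos j)) = pf j" "rmem s1 ''B'' (int (cell_pos j)) = bn j"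
      using init(1,2,5) W[of "j mod T"] W[of "Suc (j mod T)"] C[OF jt] cells[OF j] jt
      by (simp_all add: frame_imem[OF f] frame_rmem[OF f] writes add.commute)
    have guard: "bval (ILess (ivar ''i'') (ivar ''n'')) s1"
      using inv1 const jT by simp
    have "wp body (\<lambda>k s2. k \<le> K \<and> Inv (Suc j) s2) s1"
      unfolding body_def
    proof (simp, rule wp_mono[OF shift_loop_spec[where t = "int (j mod T)" and c = "C (j mod T)"
            and w = "wt j" and v = "radix C (j mod T)"]], goal_cases)
      case (7 k s2)
      then have k: "k \<le> 40 * (M + 1)" and q: "imem s2 ''q'' 0 = shift j"
        and f2: "frame shift_loop (iupdate ''j'' 0 0 (iupdate ''q'' 0 0
           (iupdate ''H'' (imem s1 ''m'' 0) (imem s1 ''h'' 0) s1))) s2"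
        using C[OF jt] by (auto simp: shift_def)
      note frs2 = frame_imem[OF f2] frame_rmem[OF f2]
      have s2: "imem s2 ''m'' 0 = int j" "imem s2 ''t'' 0 = int (j mod T)"
        "imem s2 ''i'' 0 = int (j div T)" "imem s2 ''h'' 0 = int (cell_pos j)"
        "imem s2 ''x'' 0 = X" "imem s2 ''u'' 0 = X" "imem s2 ''T'' 0 = int T"
        "imem s2 ''n'' 0 = int n" "imem s2 ''L'' 0 = L"
        "imem s2 ''W'' (int (j mod T) + 1) = radix C (Suc (j mod T))"
        "rmem s2 ''p'' (int (cell_pos j)) = pf j" "rmem s2 ''B'' (int (cell_pos j)) = bn j"
        "imem s2 ''H'' = (imem s1 ''H'')(int j := int (cell_pos j))"
        "rmem s2 ''V'' = rmem s1 ''V''" "imem s2 ''E'' = imem s1 ''E''" "imem s2 ''D'' = imem s1 ''D''"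
        by (simp_all add: frs2 inv1 const)
      let ?s2 = "iupdate ''u'' 0 (imem s2 ''u'' 0 + imem s2 ''L'' 0) (iupdate ''r'' 0 0 s2)"
      have pre: "imem ?s2 ''x'' 0 = X" "imem ?s2 ''u'' 0 = X + L" "imem ?s2 ''L'' 0 = L"
        "imem ?s2 ''q'' 0 = shift j" "imem ?s2 ''r'' 0 = 0"
        "imem ?s2 ''W'' (imem ?s2 ''t'' 0 + 1) = radix C (Suc (j mod T))"
        "rmem ?s2 ''p'' (imem ?s2 ''h'' 0) = pf j" "rmem ?s2 ''B'' (imem ?s2 ''h'' 0) = bn j"
        by (simp_all add: s2 q)
      note spec = layer_loop_spec[OF pre bn_nonneg shift_nonneg L_pos even_radix radix_ge_2]
      show ?case
      proof (simp, rule wp_mono[OF spec], goal_cases)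
        case (1 k2 s3)
        then have k2: "k2 \<le> 150 * nat L" and x: "imem s3 ''x'' 0 = X + L"
          and f3: "frame layer_loop ?s2 s3"
          and old: "\<And>x. x < X \<Longrightarrow> rmem s3 ''V'' x = rmem s1 ''V'' x \<and> imem s3 ''E'' x = imem s1 ''E'' x \<and>
            imem s3 ''D'' x = imem s1 ''D'' x"
          by (simp_all add: s2)
        have new: "cell_ok (rmem s3 ''V'') (imem s3 ''E'') (imem s3 ''D'') j"
          using 1 unfolding cell_ok_def fits_def X by blast
        have "cell_ok (rmem s3 ''V'') (imem s3 ''E'') (imem s3 ''D'') j'" if "j' < j" for j'
        proof -
          \<comment> \<open>Everything that cell \<open>j'\<close> refers to lies below
            \<open>X\<close>, where the layer written in this round begins.\<close>
          have "int (j' + 2) * L \<le> X"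
            unfolding X_def using that L_pos by (intro mult_right_mono) auto
          then have "cell_ok (rmem s3 ''V'') (imem s3 ''E'') (imem s3 ''D'') j' \<longleftrightarrow>
              cell_ok (rmem s1 ''V'') (imem s1 ''E'') (imem s1 ''D'') j'"
            by (intro cell_ok_cong old) linarith
          then show ?thesis using inv2 that by simp
        qed
        with new have ok: "\<forall>j'<Suc j. cell_ok (rmem s3 ''V'') (imem s3 ''E'') (imem s3 ''D'') j'"
          by (auto simp: less_Suc_eq)
        have "L \<le> X" unfolding X_def using L_pos by simp
        then have zero: "\<forall>x<L. rmem s3 ''V'' x = 0"
          using old inv2 by auto
        note frs3 = frame_imem[OF f3] frame_rmem[OF f3]
        have s3: "imem s3 ''m'' 0 = int j" "imem s3 ''t'' 0 = int (j mod T)"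
          "imem s3 ''i'' 0 = int (j div T)" "imem s3 ''h'' 0 = int (cell_pos j)"
          "imem s3 ''u'' 0 = X + L" "imem s3 ''T'' 0 = int T" "imem s3 ''n'' 0 = int n"
          "\<forall>j'<Suc j. imem s3 ''H'' (int j') = int (cell_pos j')"
          using inv2 by (simp_all add: frs3 s2 less_Suc_eq)
        have x': "imem s3 ''x'' 0 = int (Suc (Suc j)) * L" "imem s3 ''u'' 0 = int (Suc (Suc j)) * L"
          using x s3(5) X(1) by simp_all
        have K: "k + k2 + 60 \<le> K"
          using k k2 by (simp add: K_def)
        show ?case
        \<comment> \<open>Either the same object continues one row further in the input, or its
          times are exhausted and the next object starts in row 0.\<close>
        proof (cases "Suc (j mod T) < T")
          case True
          have "cell_pos (Suc j) = cell_pos j + n" "Suc j mod T = Suc (j mod T)" "Suc j div T = j div T"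
            using True by (auto simp: cell_pos_def mod_Suc div_Suc)
          then show ?thesis
            using K True by (simp add: Inv_def s3(1-4,6-) x'[simplified] ok zero)
        next
          case False
          with jt have "Suc (j mod T) = T" by simp
          then have "cell_pos (Suc j) = Suc (j div T)" "Suc j mod T = 0" "Suc j div T = Suc (j div T)"
            by (auto simp: cell_pos_def mod_Suc div_Suc)
          then show ?thesis
            using K False by (simp add: Inv_def s3(1-4,6-) x'[simplified] ok zero)
        qed
      qed
    qed (simp_all add: inv1 const)
    with guard show "bval (ILess (ivar ''i'') (ivar ''n'')) s1 \<and> wp body (\<lambda>k s2. k \<le> K \<and> Inv (Suc j) s2) s1"
      by simp
  next
    fix s1
    assume inv: "Inv (n * T) s1" and f: "frame body s s1"
    then show "\<not> bval (ILess (ivar ''i'') (ivar ''n'')) s1"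
      using init T by (simp add: frame_imem[OF f] writes Inv_def)
  qed (simp add: algebra_simps)
  moreover have cost: "n * T * (K + 1 + 5) + 1 + 5 \<le> n * T * (40 * (M + 1) + 150 * nat L + 100) + 10"
  proof -
    have "K + 1 + 5 \<le> 40 * (M + 1) + 150 * nat L + 100"
      by (simp add: K_def)
    from mult_left_mono[OF this, of "n * T"] show ?thesis by linarith
  qed
  ultimately show ?thesis
  proof (elim wp_mono, intro conjI)
    fix k s'
    assume a: "k \<le> n * T * (K + 1 + 5) + 1 + 5 \<and> Inv (n * T) s'"
    show "k \<le> n * T * (40 * (M + 1) + 150 * nat L + 100) + 10"
      using conjunct1[OF a] cost by (rule order_trans)
  qed (auto simp: Inv_def)
qed

section \<open>Reading the solution off backwards\<close>

lemma cell_pos_inj: "inj_on cell_pos {..<n * T}"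
proof (rule inj_onI)
  fix j j'
  assume a: "j \<in> {..<n * T}" "j' \<in> {..<n * T}" "cell_pos j = cell_pos j'"
  have "j div T < n" "j' div T < n"
    using a by (auto simp: less_mult_imp_div_less)
  then have "cell_pos j mod n = j div T" "cell_pos j' mod n = j' div T"
    "cell_pos j div n = j mod T" "cell_pos j' div n = j' mod T"
    by (auto simp: cell_pos_def)
  then show "j = j'" using a(3) by (metis div_mult_mod_eq)
qed

text \<open>\<open>X\<close> is the path of stored predecessors that ends in the current node. Each
  round writes one output entry, and \<open>cell_pos_inj\<close> protects the entries written
  before.\<close>

lemma traceback_spec:
  assumes "imem s ''m'' 0 = int K" and KnT: "K \<le> n * T"
    and H: "\<And>j. j < K \<Longrightarrow> imem s ''H'' (int j) = int (cell_pos j)"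
    and X: "X K = imem s ''x'' 0" "\<And>j. j < K \<Longrightarrow> X j = imem s ''D'' (X (Suc j))"
  shows "wp traceback (\<lambda>k s'. k \<le> K * 50 + 10 \<and>
      (\<forall>j<K. imem s' ''S'' (int (cell_pos j)) = imem s ''E'' (X (Suc j)))) s"
proof -
  define body where "body =
     (iset ''m'' (ISub (ivar ''m'') (IConst 1)) ;;
      IPut ''S'' (IGet ''H'' (ivar ''m'')) (IGet ''E'' (ivar ''x'')) ;;
      iset ''x'' (IGet ''D'' (ivar ''x'')))"
  have writes: "iwrites body = {''m'', ''S'', ''x''}"
    by (auto simp: body_def)
  define Inv where "Inv i s' \<longleftrightarrow> imem s' ''m'' 0 = int (K - i) \<and> imem s' ''x'' 0 = X (K - i) \<and>
      (\<forall>j. K - i \<le> j \<and> j < K \<longrightarrow> imem s' ''S'' (int (cell_pos j)) = imem s ''E'' (X (Suc j)))" for i and s' :: state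
  have "wp traceback (\<lambda>k s'. k \<le> K * (30 + 1 + 4) + 1 + 4 \<and> Inv K s') s"
    unfolding traceback_def body_def[symmetric]
  proof (rule wp_mono[OF wp_while[where Inv = Inv and K = 30 and m = K]])
    show "Inv 0 s" using assms(1) X(1) by (simp add: Inv_def)
  next
    fix i s1
    assume i: "i < K" and inv: "Inv i s1" and f: "frame body s s1"
    define j where "j = K - Suc i"
    have j: "K - i = Suc j" "j < K" "K - Suc i = j" using i by (auto simp: j_def)
    have split: "j \<le> j' \<longleftrightarrow> j' = j \<or> Suc j \<le> j'" for j'
      by auto
    have pos: "cell_pos j' \<noteq> cell_pos j" if "Suc j \<le> j'" "j' < K" for j'
      using inj_onD[OF cell_pos_inj, of j' j] that j KnT by auto
    have "wp body (\<lambda>k s2. k \<le> 30 \<and> Inv (Suc i) s2) s1"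
      using inv[unfolded Inv_def j(1)] H[OF j(2)] X(2)[OF j(2)] pos
      unfolding Inv_def j(3) split body_def by (auto simp: frame_imem[OF f] writes)
    then show "bval (ILess (IConst 0) (ivar ''m'')) s1 \<and> wp body (\<lambda>k s2. k \<le> 30 \<and> Inv (Suc i) s2) s1"
      using inv j by (simp add: Inv_def)
  next
    fix s1
    assume "Inv K s1"
    then show "\<not> bval (ILess (IConst 0) (ivar ''m'')) s1"
      by (simp add: Inv_def)
  qed simp
  then show ?thesis
    by (rule wp_mono) (auto simp: Inv_def)
qed

end

section \<open>Values of nodes\<close>

context knapsack_chain
begin

section \<open>Mixed-radix encoding of capacity vectors\<close>

definition enc :: "(nat \<Rightarrow> nat) \<Rightarrow> int" where
  "enc c = (\<Sum>t<T. int (c t) * radix C t)"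

text \<open>The extreme case is that all digits are maximal; with \<open>W = radix C m\<close>, the
  induction step is \<open>(W - 2) + C m * W = radix C (Suc m) - 2\<close>.\<close>

lemma radix_prefix_bounds:
  assumes "\<And>u. u < m \<Longrightarrow> c u \<le> C u"
  shows "(\<Sum>u<m. int (c u) * radix C u) \<le> radix C m - 2" "0 \<le> (\<Sum>u<m. int (c u) * radix C u)"
proof -
  show "(\<Sum>u<m. int (c u) * radix C u) \<le> radix C m - 2"
    using assms
  proof (induction m)
    case (Suc m)
    have "int (c m) * radix C m \<le> int (C m) * radix C m"
      using Suc.prems radix_ge_2[of C m] by (intro mult_right_mono) auto
    with Suc.IH Suc.prems show ?case
      by (simp add: radix_Suc algebra_simps)
  qed simp
  show "0 \<le> (\<Sum>u<m. int (c u) * radix C u)"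
  proof (intro sum_nonneg mult_nonneg_nonneg)
    show "0 \<le> radix C u" for u
      using radix_ge_2[of C u] by simp
  qed simp
qed

lemma radix_dvd: "s \<le> t \<Longrightarrow> radix C s dvd radix C t"
  by (induction t rule: dec_induct) (auto simp: radix_Suc intro: dvd_mult2)

text \<open>Digits from \<open>m\<close> on contribute a multiple of \<open>radix C m\<close>; those
  below stay under it by \<open>radix_prefix_bounds\<close>.\<close>

lemma enc_mod:
  assumes "\<And>t. t < T \<Longrightarrow> c t \<le> C t" "m \<le> T"
  shows "enc c mod radix C m = (\<Sum>u<m. int (c u) * radix C u)"
proof -
  define lo where "lo = (\<Sum>u<m. int (c u) * radix C u)"
  define hi where "hi = (\<Sum>u=m..<T. int (c u) * radix C u)"
  have "{..<T} = {..<m} \<union> {m..<T}" using assms by auto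
  then have "enc c = (\<Sum>u\<in>{..<m} \<union> {m..<T}. int (c u) * radix C u)"
    by (simp only: enc_def)
  also have "\<dots> = lo + hi"
    unfolding lo_def hi_def by (rule sum.union_disjoint) auto
  finally have "enc c = lo + hi" .
  moreover have "radix C m dvd hi"
    unfolding hi_def by (intro dvd_sum dvd_mult radix_dvd) simp
  then obtain k where "hi = radix C m * k" ..
  moreover have "c u \<le> C u" if "u < m" for u
    using assms that by simp
  then have "0 \<le> lo" "lo < radix C m"
    using radix_prefix_bounds[of m c] unfolding lo_def by auto
  ultimately show ?thesis by (simp add: lo_def)
qed

lemma enc_bounds:
  assumes "\<And>t. t < T \<Longrightarrow> c t \<le> C t"
  shows "0 \<le> enc c" "enc c < L" "even (enc c)"
  using radix_prefix_bounds[of T c] assms unfolding enc_def L_def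
  by (auto intro: dvd_sum)

text \<open>Full capacities have the largest even code, which is why the traceback starts at
  \<open>x - 2\<close>.\<close>

lemma enc_capacity: "enc C = L - 2"
proof -
  have "(\<Sum>u<m. int (C u) * radix C u) = radix C m - 2" for m
    by (induction m) (simp_all add: radix_Suc algebra_simps)
  then show ?thesis by (simp add: enc_def L_def)
qed

text \<open>The digits below \<open>t\<close> sum to less than one unit \<open>radix C t\<close>, so
  they cannot tip the comparison.\<close>

lemma fits_enc:
  assumes "\<And>t. t < T \<Longrightarrow> c t \<le> C t"
  shows "fits j (enc c) \<longleftrightarrow> wt j \<le> c (j mod T)"
proof -
  define t where "t = j mod T"
  define lo where "lo = (\<Sum>u<t. int (c u) * radix C u)"
  define m where "m = min (wt j) (C t + 1)"
  have t: "t < T" using T by (simp add: t_def)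
  then have lo: "0 \<le> lo" "lo < radix C t" and ct: "c t \<le> C t"
    using radix_prefix_bounds[of t c] assms unfolding lo_def by force+
  have "enc c mod radix C (Suc t) = lo + int (c t) * radix C t"
    using enc_mod[of c "Suc t"] assms t by (simp add: lo_def)
  then have "fits j (enc c) \<longleftrightarrow> int m * radix C t \<le> lo + int (c t) * radix C t"
    by (simp add: fits_def shift_def m_def t_def)
  also have "\<dots> \<longleftrightarrow> m \<le> c t"
  proof
    assume "m \<le> c t"
    then have "int m * radix C t \<le> int (c t) * radix C t"
      using radix_ge_2[of C t] by (intro mult_right_mono) auto
    with lo show "int m * radix C t \<le> lo + int (c t) * radix C t" by linarith
  next
    assume a: "int m * radix C t \<le> lo + int (c t) * radix C t"
    show "m \<le> c t"
    proof (rule ccontr)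
      assume "\<not> m \<le> c t"
      then have "(int (c t) + 1) * radix C t \<le> int m * radix C t"
        using radix_ge_2[of C t] by (intro mult_right_mono) auto
      with a lo show False by (simp add: algebra_simps)
    qed
  qed
  \<comment> \<open>Cutting the weight off at \<open>C t + 1\<close> is harmless because
    \<open>c t \<le> C t\<close>: the cut-off weight still does not fit.\<close>
  also have "\<dots> \<longleftrightarrow> wt j \<le> c t"
    using ct by (auto simp: m_def)
  finally show ?thesis by (simp add: t_def)
qed

text \<open>A fitting weight is at most \<open>C t\<close>, so the cut-off is inactive and only
  digit \<open>t\<close> changes, without a borrow.\<close>

lemma enc_shift:
  assumes "\<And>t. t < T \<Longrightarrow> c t \<le> C t" "wt j \<le> c (j mod T)"
  shows "enc (c(j mod T := c (j mod T) - wt j)) = enc c - shift j"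
proof -
  define t where "t = j mod T"
  have t: "t < T" using T by (simp add: t_def)
  then have "wt j \<le> C t" "wt j \<le> c t" using assms unfolding t_def by (auto intro: order_trans)
  then have "shift j = int (wt j) * radix C t"
    by (simp add: shift_def t_def)
  moreover have "enc (c(t := v)) = int v * radix C t + (\<Sum>u\<in>{..<T} - {t}. int (c u) * radix C u)" for v
    using t unfolding enc_def by (subst sum.remove[of _ t]) auto
  from this[of "c t"] this[of "c t - wt j"]
  have "enc (c(t := c t - wt j)) = enc c - int (wt j) * radix C t"
    using \<open>wt j \<le> c t\<close> by (simp add: of_nat_diff algebra_simps)
  ultimately show ?thesis by (simp add: t_def)
qed

section \<open>Feasibility and gain along the chain\<close>

primrec feasible :: "(nat \<Rightarrow> bool) \<Rightarrow> nat \<Rightarrow> (nat \<Rightarrow> nat) \<Rightarrow> bool" where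
  "feasible f 0 c \<longleftrightarrow> True"
| "feasible f (Suc j) c \<longleftrightarrow>
     (if f j then wt j \<le> c (j mod T) \<and> feasible f j (c(j mod T := c (j mod T) - wt j))
      else feasible f j c)"

text \<open>\<open>b\<close> is the choice in the cell after the first \<open>j\<close>; it decides
  the last bonus and is all that a prefix must know about the rest besides the capacities.\<close>

primrec gain :: "(nat \<Rightarrow> bool) \<Rightarrow> nat \<Rightarrow> bool \<Rightarrow> real" where
  "gain f 0 b = 0"
| "gain f (Suc j) b =
     gain f j (f j) + (if f j then pf j else 0) + (if f j = b then bn j else 0)"

definition node :: "nat \<Rightarrow> (nat \<Rightarrow> nat) \<Rightarrow> bool \<Rightarrow> int" where
  "node j c b = int j * L + enc c + of_bool b"

text \<open>Passes from codes to capacity vectors: \<open>fits_enc\<close> turns the residue test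
  into a weight comparison, and \<open>enc_shift\<close> identifies \<open>z\<close>.\<close>

lemma cell_ok_node:
  fixes b :: bool
  assumes "cell_ok V E D j" and c: "\<And>t. t < T \<Longrightarrow> c t \<le> C t"
  defines "x \<equiv> node (Suc j) c b"
  defines "y \<equiv> node j c False"
  defines "z \<equiv> node j (c(j mod T := c (j mod T) - wt j)) True"
  shows "E x \<noteq> 1 \<and> D x = y \<or> wt j \<le> c (j mod T) \<and> E x = 1 \<and> D x = z"
    and "V x = V (D x) + (if E x = 1 then pf j else 0) + (if (E x = 1) = b then bn j else 0)"
    and "V y + (if b then 0 else bn j) \<le> V x"
    and "wt j \<le> c (j mod T) \<Longrightarrow> V z + pf j + (if b then bn j else 0) \<le> V x"
proof -
  have "of_bool b = (0 :: int) \<or> of_bool b = (1 :: int)" by auto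
  then have ok: "node_ok V E D (fits j (enc c)) (pf j) (bn j) (int j * L + enc c)
      (int j * L + enc c - shift j + 1) (int (Suc j) * L + enc c + of_bool b) (of_bool b)"
    using assms(1) enc_bounds[of c] c unfolding cell_ok_def by blast
  moreover have "fits j (enc c) \<longleftrightarrow> wt j \<le> c (j mod T)" using fits_enc c by blast
  moreover have "int j * L + enc c = y" "int (Suc j) * L + enc c + of_bool b = x"
    by (simp_all add: node_def x_def y_def)
  moreover have "wt j \<le> c (j mod T) \<Longrightarrow> int j * L + enc c - shift j + 1 = z"
    using enc_shift[of c j] c by (simp add: node_def z_def)
  ultimately have ok': "node_ok V E D (wt j \<le> c (j mod T)) (pf j) (bn j) y z x (of_bool b)"
    by (cases "wt j \<le> c (j mod T)") (auto simp: node_ok_def)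
  then show "E x \<noteq> 1 \<and> D x = y \<or> wt j \<le> c (j mod T) \<and> E x = 1 \<and> D x = z"
    by (auto simp: node_ok_def)
  show "V x = V (D x) + (if E x = 1 then pf j else 0) + (if (E x = 1) = b then bn j else 0)"
    "V y + (if b then 0 else bn j) \<le> V x"
    "wt j \<le> c (j mod T) \<Longrightarrow> V z + pf j + (if b then bn j else 0) \<le> V x"
    using ok' unfolding node_ok_def by (auto split: if_splits)
qed

text \<open>Each node dominates both of its continuations, so no feasible selection beats the stored
  value. The induction varies \<open>c\<close> and \<open>b\<close> because a predecessor has its
  own.\<close>

lemma gain_le_value:
  assumes ok: "\<And>j. j < K \<Longrightarrow> cell_ok V E D j" and V0: "\<And>x. x < L \<Longrightarrow> V x = 0"
  shows "j \<le> K \<Longrightarrow> (\<And>t. t < T \<Longrightarrow> c t \<le> C t) \<Longrightarrow> feasible f j c \<Longrightarrow> gain f j b \<le> V (node j c b)"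
proof (induction j arbitrary: c b)
  case 0
  \<comment> \<open>Parity leaves room for the bit, so the node stays in layer 0, where all values
    are 0.\<close>
  have "enc c + 1 < L" using enc_bounds[of c] 0 L_pos even_add_1_less by blast
  then have "node 0 c b < L" by (simp add: node_def)
  then show ?case by (simp add: V0)
next
  case (Suc j)
  note cell = cell_ok_node[OF ok[of j], of c b]
  show ?case
  proof (cases "f j")
    case True
    let ?c = "c(j mod T := c (j mod T) - wt j)"
    have "?c t \<le> C t" if "t < T" for t
      using Suc.prems(2)[OF that] by auto
    then have "gain f j True \<le> V (node j ?c True)"
      using Suc True by auto
    moreover have "wt j \<le> c (j mod T)" using Suc.prems True by simp
    ultimately show ?thesis
      using cell(4) Suc.prems True by fastforce
  next
    case False
    then have "gain f j False \<le> V (node j c False)"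
      using Suc by auto
    then show ?thesis
      using cell(3) Suc.prems False by fastforce
  qed
qed

text \<open>The counterpart of \<open>gain_le_value\<close>: along the stored predecessors, each
  step spends the capacity and earns the profit and bonus accounted for in the node, so the bound is
  attained.\<close>

lemma traceback_value:
  assumes ok: "\<And>j. j < K \<Longrightarrow> cell_ok V E D j" and V0: "\<And>x. x < L \<Longrightarrow> V x = 0"
  shows "j \<le> K \<Longrightarrow> (\<And>t. t < T \<Longrightarrow> c t \<le> C t) \<Longrightarrow> X j = node j c b \<Longrightarrow>
    (\<And>i. i < j \<Longrightarrow> X i = D (X (Suc i)) \<and> f i = (E (X (Suc i)) = 1)) \<Longrightarrow>
    feasible f j c \<and> gain f j b = V (X j)"
proof (induction j arbitrary: c b)
  case 0
  have "enc c + 1 < L" using enc_bounds[of c] 0 L_pos even_add_1_less by blast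
  then have "node 0 c b < L" by (simp add: node_def)
  then show ?case using 0 by (simp add: V0)
next
  case (Suc j)
  have cell: "E (X (Suc j)) \<noteq> 1 \<and> D (X (Suc j)) = node j c False \<or>
      wt j \<le> c (j mod T) \<and> E (X (Suc j)) = 1 \<and>
      D (X (Suc j)) = node j (c(j mod T := c (j mod T) - wt j)) True"
    "V (X (Suc j)) = V (D (X (Suc j))) + (if E (X (Suc j)) = 1 then pf j else 0)
       + (if (E (X (Suc j)) = 1) = b then bn j else 0)"
    using cell_ok_node(1,2)[OF ok[of j], of c b] Suc.prems by auto
  have Xj: "X j = D (X (Suc j))" "f j = (E (X (Suc j)) = 1)"
    using Suc.prems(4) by auto
  show ?case
  proof (cases "f j")
    case True
    let ?c = "c(j mod T := c (j mod T) - wt j)"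
    have c: "?c t \<le> C t" if "t < T" for t
      using Suc.prems(2)[OF that] by auto
    have "feasible f j ?c \<and> gain f j True = V (X j)"
    proof (rule Suc.IH)
      show "X j = node j ?c True" using cell(1) Xj True by auto
    qed (use Suc.prems c in auto)
    then show ?thesis using cell Xj True by auto
  next
    case False
    have "feasible f j c \<and> gain f j False = V (X j)"
    proof (rule Suc.IH)
      show "X j = node j c False" using cell(1) Xj False by auto
    qed (use Suc.prems in auto)
    then show ?thesis using cell Xj False by auto
  qed
qed

text \<open>Each subtraction is guarded by \<open>wt j \<le> c (j mod T)\<close> and never
  truncates, so only the total load per time counts.\<close>

lemma feasible_iff:
  "feasible f j c \<longleftrightarrow> (\<forall>t. (\<Sum>i<j. if f i \<and> i mod T = t then wt i else 0) \<le> c t)"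
proof (induction j arbitrary: c)
  case (Suc j)
  let ?S = "\<lambda>t. \<Sum>i<j. if f i \<and> i mod T = t then wt i else 0"
  show ?case
  proof (cases "f j")
    case True
    have "feasible f (Suc j) c \<longleftrightarrow> wt j \<le> c (j mod T) \<and>
        (\<forall>t. ?S t \<le> (c(j mod T := c (j mod T) - wt j)) t)"
      using True by (simp add: Suc.IH)
    also have "\<dots> \<longleftrightarrow> (\<forall>t. ?S t + (if j mod T = t then wt j else 0) \<le> c t)"
      (is "?l \<longleftrightarrow> ?r")
    proof
      assume ?l
      then show ?r
        by (auto simp: fun_upd_def split: if_splits)
    next
      assume r: ?r
      from r[rule_format, of "j mod T"] have j: "?S (j mod T) + wt j \<le> c (j mod T)" by simp
      then have "?S t \<le> (c(j mod T := c (j mod T) - wt j)) t" for t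
        using r[rule_format, of t] by (auto split: if_splits)
      with j show ?l by auto
    qed
    finally show ?thesis using True by simp
  qed (simp add: Suc.IH)
qed simp

text \<open>When the recursion is unrolled, the bit seen by an inner cell becomes
  \<open>f (Suc i)\<close>; only the last cell sees \<open>b\<close>.\<close>

lemma gain_eq:
  "gain f j b = (\<Sum>i<j. if f i then pf i else 0) +
     (\<Sum>i<j. if f i = (if Suc i = j then b else f (Suc i)) then bn i else 0)"
proof (induction j arbitrary: b)
  case (Suc j)
  have "(\<Sum>i<j. if f i = (if Suc i = j then f j else f (Suc i)) then bn i else 0) =
     (\<Sum>i<j. if f i = (if Suc i = Suc j then b else f (Suc i)) then bn i else 0)"
    by (intro sum.cong) auto
  then show ?case by (simp add: Suc.IH)
qed simp

end

section \<open>Correctness on instances\<close>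

lemma sum_cells:
  fixes g :: "nat \<Rightarrow> nat \<Rightarrow> 'a::comm_monoid_add"
  assumes "T \<ge> 1"
  shows "(\<Sum>j<n * T. g (j mod T) (j div T)) = (\<Sum>t<T. \<Sum>i<n. g t i)"
proof (induction n)
  case (Suc n)
  have "{..<Suc n * T} = {..<n * T} \<union> (\<lambda>t. n * T + t) ` {..<T}"
  proof (rule set_eqI)
    fix x
    show "x \<in> {..<Suc n * T} \<longleftrightarrow> x \<in> {..<n * T} \<union> (\<lambda>t. n * T + t) ` {..<T}"
      by (cases "x < n * T") (auto intro!: image_eqI[of _ _ "x - n * T"])
  qed
  then have "(\<Sum>j<Suc n * T. g (j mod T) (j div T)) =
      (\<Sum>j<n * T. g (j mod T) (j div T)) + (\<Sum>j\<in>(\<lambda>t. n * T + t) ` {..<T}. g (j mod T) (j div T))"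
    by (simp only:) (rule sum.union_disjoint, auto)
  also have "(\<Sum>j\<in>(\<lambda>t. n * T + t) ` {..<T}. g (j mod T) (j div T)) = (\<Sum>t<T. g t n)"
    by (subst sum.reindex) (auto simp: o_def)
  finally show ?case
    by (simp only: Suc.IH) (simp add: sum.distrib)
qed simp

lemma sum_subset_shift:
  fixes h :: "nat \<Rightarrow> 'a::comm_monoid_add"
  assumes "S \<subseteq> {1..n}"
  shows "(\<Sum>i\<in>S. h i) = (\<Sum>i<n. if Suc i \<in> S then h (Suc i) else 0)"
proof -
  have "(\<Sum>i\<in>S. h i) = (\<Sum>i\<in>{1..n}. if i \<in> S then h i else 0)"
    using assms by (intro sum.mono_neutral_cong_left) auto
  also have "\<dots> = (\<Sum>i<n. if Suc i \<in> S then h (Suc i) else 0)"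
    by (simp add: sum.atLeast1_atMost_eq)
  finally show ?thesis .
qed

lemma length_rows: "length (concat (map (\<lambda>t. map (g t) [1..<n + 1]) [1..<m + 1])) = m * n"
  by (induction m) auto

lemma nth_rows:
  "t < m \<Longrightarrow> i < n \<Longrightarrow>
    concat (map (\<lambda>t. map (g t) [1..<n + 1]) [1..<m + 1]) ! (t * n + i) = g (Suc t) (Suc i)"
proof (induction m)
  case (Suc m)
  let ?r = "\<lambda>m. concat (map (\<lambda>t. map (g t) [1..<n + 1]) [1..<m + 1])"
  have r: "?r (Suc m) = ?r m @ map (g (Suc m)) [1..<n + 1]"
    by simp
  show ?case
  proof (cases "t < m")
    case True
    then have "(t + 1) * n \<le> m * n" by (intro mult_right_mono) auto
    then have "t * n + i < length (?r m)"
      unfolding length_rows using Suc.prems by simp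
    then show ?thesis
      unfolding r using Suc True by (simp only: nth_append if_True)
  next
    case False
    with Suc.prems have "t = m" by simp
    then show ?thesis
      unfolding r nth_append length_rows using Suc.prems by (simp del: upt_Suc)
  qed
qed simp

lemma list_array_int: "list_array xs (int k) = (if k < length xs then xs ! k else 0)"
  by (simp add: list_array_def)

text \<open>Rows beyond the last read as 0; with \<open>m = T - 1\<close> this supplies the bonus 0
  at the last time.\<close>

lemma list_array_rows:
  assumes "i < n"
  shows "list_array (concat (map (\<lambda>t. map (g t) [1..<n + 1]) [1..<m + 1])) (int (t * n + i)) =
    (if t < m then g (Suc t) (Suc i) else 0)"
proof -
  have "t * n + i < m * n \<longleftrightarrow> t < m"
  proof
    assume "t < m"
    then have "(t + 1) * n \<le> m * n" by (intro mult_right_mono) auto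
    with assms show "t * n + i < m * n" by simp
  next
    assume "t * n + i < m * n"
    then have "t * n < m * n" by (rule le_less_trans[OF le_add1])
    then show "t < m" by simp
  qed
  then show ?thesis
    using nth_rows[of t m i n g] assms unfolding list_array_int length_rows by (auto simp del: upt_Suc)
qed

section \<open>The chain of an instance\<close>

locale valid_knapsack =
  fixes I :: mk_instance
  assumes valid: "valid_instance I"
begin

abbreviation "T \<equiv> horizon I"
abbreviation "n \<equiv> num_objects I"

text \<open>The value 0 at the last time decouples consecutive objects. The test
  \<open>j div T < n\<close> gives nonnegativity for every \<open>j\<close>, while validity speaks
  only of actual objects.\<close>

definition cell_bonus :: "nat \<Rightarrow> real" where
  "cell_bonus j = (if Suc (j mod T) < T \<and> j div T < n then bonus I (Suc (j mod T)) (Suc (j div T)) else 0)"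

sublocale knapsack_chain T n "\<lambda>t. capacity I (Suc t)"
  "\<lambda>j. weight I (Suc (j mod T)) (Suc (j div T))" "\<lambda>j. profit I (Suc (j mod T)) (Suc (j div T))"
  cell_bonus
proof
  show "T \<ge> 1" using valid by (simp add: valid_instance_def)
  show "0 \<le> cell_bonus j" for j
    using valid by (auto simp: cell_bonus_def valid_instance_def objects_def)
qed

lemma input_cells:
  assumes "j < n * T"
  shows "imem (input_state I) ''w'' (int (cell_pos j)) = int (weight I (Suc (j mod T)) (Suc (j div T)))"
    and "rmem (input_state I) ''p'' (int (cell_pos j)) = profit I (Suc (j mod T)) (Suc (j div T))"
    and "rmem (input_state I) ''B'' (int (cell_pos j)) = cell_bonus j"
proof -
  have i: "j div T < n" using assms by (simp add: less_mult_imp_div_less)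
  have t: "j mod T < T" using T by simp
  have B: "[1..<T] = [1..<(T - 1) + 1]" using T by simp
  have "j mod T < T - 1 \<longleftrightarrow> Suc (j mod T) < T" by auto
  then show "imem (input_state I) ''w'' (int (cell_pos j)) = int (weight I (Suc (j mod T)) (Suc (j div T)))"
    "rmem (input_state I) ''p'' (int (cell_pos j)) = profit I (Suc (j mod T)) (Suc (j div T))"
    "rmem (input_state I) ''B'' (int (cell_pos j)) = cell_bonus j"
    using list_array_rows[OF i, of "\<lambda>t i. int (weight I t i)" T "j mod T"]
      list_array_rows[OF i, of "profit I" T "j mod T"]
      list_array_rows[OF i, of "bonus I" "T - 1" "j mod T"] t i
    unfolding B[symmetric]
    by (simp_all add: input_state_def input_imem_def input_rmem_def cell_pos_def cell_bonus_def del: upt_Suc)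
qed

lemma input_capacity:
  assumes "t < T"
  shows "imem (input_state I) ''C'' (int t) = int (capacity I (Suc t))"
    "capacity I (Suc t) + 1 \<le> max_capacity I + 1"
proof -
  show "imem (input_state I) ''C'' (int t) = int (capacity I (Suc t))"
    using assms by (simp add: input_state_def input_imem_def list_array_def del: upt_Suc)
  show "capacity I (Suc t) + 1 \<le> max_capacity I + 1"
    unfolding max_capacity_def using assms by (auto intro!: Max_ge)
qed

text \<open>Since \<open>T \<ge> 1\<close>, the single factor 2 is at most \<open>2 ^ T\<close>,
  which puts a 2 on each of the \<open>T\<close> factors.\<close>

lemma L_le: "nat L \<le> (2 * max_capacity I + 2) ^ T"
proof -
  have "L = int (2 * (\<Prod>t<T. capacity I (Suc t) + 1))"
    by (simp add: L_def radix_def algebra_simps)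
  then have "nat L = 2 * (\<Prod>t<T. capacity I (Suc t) + 1)"
    by (metis nat_int)
  also have "\<dots> \<le> 2 * (\<Prod>t<T. max_capacity I + 1)"
    using input_capacity(2) by (intro mult_left_mono prod_mono) auto
  also have "\<dots> \<le> 2 ^ T * (max_capacity I + 1) ^ T"
    using T self_le_power[of "2::nat" T] by (simp add: mult_right_mono)
  also have "\<dots> = (2 * max_capacity I + 2) ^ T"
    by (simp add: power_mult_distrib[symmetric] algebra_simps)
  finally show ?thesis .
qed

definition choices :: "(nat \<Rightarrow> nat set) \<Rightarrow> nat \<Rightarrow> bool" where
  "choices S j \<longleftrightarrow> Suc (j div T) \<in> S (Suc (j mod T))"

text \<open>Grouping the cells by time turns the load in \<open>feasible_iff\<close> into the weight
  packed at that time; beyond the horizon it is 0.\<close>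

lemma feasible_choices:
  assumes "\<And>t. t \<in> {1..T} \<Longrightarrow> S t \<subseteq> objects I"
  shows "feasible (choices S) (n * T) (\<lambda>t. capacity I (Suc t)) \<longleftrightarrow> is_solution I S"
proof -
  let ?load = "\<lambda>t. \<Sum>j<n * T. if choices S j \<and> j mod T = t then weight I (Suc (j mod T)) (Suc (j div T)) else 0"
  have load: "?load t = (if t < T then \<Sum>i\<in>S (Suc t). weight I (Suc t) i else 0)" for t
  proof -
    have "?load t = (\<Sum>t'<T. \<Sum>i<n. if Suc i \<in> S (Suc t') \<and> t' = t then weight I (Suc t') (Suc i) else 0)"
      unfolding choices_def using T
      by (rule sum_cells[of T "\<lambda>t' i. if Suc i \<in> S (Suc t') \<and> t' = t then weight I (Suc t') (Suc i) else 0"])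
    also have "\<dots> = (\<Sum>t'<T. if t' = t then \<Sum>i<n. if Suc i \<in> S (Suc t) then weight I (Suc t) (Suc i) else 0 else 0)"
      by (intro sum.cong) auto
    also have "\<dots> = (if t < T then \<Sum>i<n. if Suc i \<in> S (Suc t) then weight I (Suc t) (Suc i) else 0 else 0)"
      by (simp add: sum.delta)
    also have "\<dots> = (if t < T then \<Sum>i\<in>S (Suc t). weight I (Suc t) i else 0)"
      using assms[of "Suc t"] by (simp add: sum_subset_shift[of _ n] objects_def)
    finally show ?thesis .
  qed
  have "feasible (choices S) (n * T) (\<lambda>t. capacity I (Suc t)) \<longleftrightarrow>
      (\<forall>t<T. (\<Sum>i\<in>S (Suc t). weight I (Suc t) i) \<le> capacity I (Suc t))"
    unfolding feasible_iff load by simp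
  also have "\<dots> \<longleftrightarrow> (\<forall>t\<in>{1..T}. (\<Sum>i\<in>S t. weight I t i) \<le> capacity I t)"
    by (metis Suc_le_eq Suc_pred' atLeastAtMost_iff le_numeral_extra(3) less_eq_Suc_le not_less_eq_eq One_nat_def Suc_le_mono zero_le)
  also have "\<dots> \<longleftrightarrow> is_solution I S"
    using assms unfolding is_solution_def by blast
  finally show ?thesis .
qed

text \<open>Either \<open>b\<close> gives the same gain: the final cell of the chain, if any, is the
  last time of an object and has bonus 0.\<close>

lemma gain_choices:
  assumes S: "\<And>t. t \<in> {1..T} \<Longrightarrow> S t \<subseteq> objects I"
  shows "gain (choices S) (n * T) b = solution_value I S"
proof -
  have "(\<Sum>j<n * T. if choices S j then profit I (Suc (j mod T)) (Suc (j div T)) else 0) =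
      (\<Sum>t<T. \<Sum>i<n. if Suc i \<in> S (Suc t) then profit I (Suc t) (Suc i) else 0)"
    unfolding choices_def using T
    by (rule sum_cells[of T "\<lambda>t i. if Suc i \<in> S (Suc t) then profit I (Suc t) (Suc i) else 0"])
  also have "\<dots> = (\<Sum>t<T. \<Sum>i\<in>S (Suc t). profit I (Suc t) i)"
    using S by (intro sum.cong refl sum_subset_shift[symmetric]) (auto simp: objects_def)
  also have "\<dots> = (\<Sum>t\<in>{1..T}. \<Sum>i\<in>S t. profit I t i)"
    by (simp add: sum.atLeast1_atMost_eq)
  finally have profits: "(\<Sum>j<n * T. if choices S j then profit I (Suc (j mod T)) (Suc (j div T)) else 0) =
    (\<Sum>t\<in>{1..T}. \<Sum>i\<in>S t. profit I t i)" .
  let ?g = "\<lambda>t i. if Suc t < T \<and> (Suc i \<in> S (Suc t) \<longleftrightarrow> Suc i \<in> S (Suc (Suc t)))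
    then bonus I (Suc t) (Suc i) else 0"
  have "(\<Sum>j<n * T. if choices S j = (if Suc j = n * T then b else choices S (Suc j)) then cell_bonus j else 0) =
      (\<Sum>j<n * T. ?g (j mod T) (j div T))"
  proof (rule sum.cong[OF refl])
    fix j
    assume "j \<in> {..<n * T}"
    then have "j div T < n" by (simp add: less_mult_imp_div_less)
    show "(if choices S j = (if Suc j = n * T then b else choices S (Suc j)) then cell_bonus j else 0) =
      ?g (j mod T) (j div T)"
    \<comment> \<open>Before the last time, the next cell is the same object one time later;
      \<open>Suc j\<close> is then no multiple of \<open>T\<close>, so the chain does not end and
      \<open>b\<close> is not consulted.\<close>
    proof (cases "Suc (j mod T) < T")
      case True
      then have "Suc j mod T = Suc (j mod T)" "Suc j div T = j div T"
        by (auto simp: mod_Suc div_Suc)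
      moreover from this have "Suc j \<noteq> n * T"
        by (metis Zero_not_Suc mod_mult_self2_is_0)
      ultimately show ?thesis
        using True \<open>j div T < n\<close> by (simp add: choices_def cell_bonus_def)
    qed (simp add: cell_bonus_def)
  qed
  also have "\<dots> = (\<Sum>t<T. \<Sum>i<n. ?g t i)"
    using T by (rule sum_cells)
  also have "\<dots> = (\<Sum>t<T - 1. \<Sum>i<n. ?g t i)"
    using T by (intro sum.mono_neutral_right ballI sum.neutral) auto
  also have "\<dots> = (\<Sum>t<T - 1. \<Sum>i\<in>stable_objects I S (Suc t). bonus I (Suc t) i)"
  proof (rule sum.cong[OF refl])
    fix t
    assume t: "t \<in> {..<T - 1}"
    then have "S (Suc t) \<subseteq> objects I" "S (Suc (Suc t)) \<subseteq> objects I"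
      using S by auto
    then have "stable_objects I S (Suc t) \<subseteq> {1..n}"
      and mem: "Suc i \<in> stable_objects I S (Suc t) \<longleftrightarrow> (Suc i \<in> S (Suc t) \<longleftrightarrow> Suc i \<in> S (Suc (Suc t)))"
      if "i < n" for i
      using that by (auto simp: stable_objects_def objects_def)
    then have "stable_objects I S (Suc t) \<subseteq> {1..n}"
      using \<open>S (Suc t) \<subseteq> objects I\<close> by (auto simp: stable_objects_def objects_def)
    then show "(\<Sum>i<n. ?g t i) = (\<Sum>i\<in>stable_objects I S (Suc t). bonus I (Suc t) i)"
      using t mem by (subst sum_subset_shift) (auto intro!: sum.cong)
  qed
  also have "\<dots> = (\<Sum>t\<in>{1..T - 1}. \<Sum>i\<in>stable_objects I S t. bonus I t i)"
    by (simp add: sum.atLeast1_atMost_eq)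
  finally show ?thesis
    unfolding gain_eq solution_value_def profits by simp
qed

lemma knapsack_program_correct:
  "\<exists>k s. runs knapsack_program (input_state I) k s \<and> is_optimal_solution I (output_solution I s) \<and>
     (n \<ge> 1 \<longrightarrow> k \<le> 1000 * (T * (2 * max_capacity I + 2) ^ T * n))"
proof -
  define M where "M = max_capacity I + 1"
  define cost where "cost = 100 + (T * (30 * M + 50) + 10) +
    (n * T * (40 * (M + 1) + 150 * nat L + 100) + 10) + (n * T * 50 + 10)"
  let ?C = "\<lambda>t. capacity I (Suc t)"
  let ?s1 = "iupdate ''W'' 0 2 (input_state I)"
  have in1: "imem (input_state I) ''T'' 0 = int T" "imem (input_state I) ''n'' 0 = int n"
    by (simp_all add: input_state_def input_imem_def list_array_def)
  have zero: "imem (input_state I) a = (\<lambda>_. 0)" if "a \<notin> {''T'', ''n'', ''C'', ''w''}" for a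
    using that by (auto simp: input_state_def input_imem_def)
  have zeroV: "rmem (input_state I) ''V'' = (\<lambda>_. 0)"
    by (simp add: input_state_def input_rmem_def)
  have "wp knapsack_program (\<lambda>k s. k \<le> cost \<and> is_optimal_solution I (output_solution I s)) (input_state I)"
    unfolding knapsack_program_def
  proof (simp, rule wp_mono[OF radices_spec[where T = T and C = ?C and M = M]], goal_cases)
    case (5 k1 s1)
    then have k1: "k1 \<le> T * (30 * M + 50) + 10"
      and W: "\<And>t. t \<le> T \<Longrightarrow> imem s1 ''W'' (int t) = radix ?C t"
      and f1: "frame radices ?s1 s1" by auto
    note fr1 = frame_imem[OF f1] frame_rmem[OF f1]
    let ?s2 = "iupdate ''t'' 0 0 (iupdate ''u'' 0 L (iupdate ''x'' 0 L (iupdate ''L'' 0 L s1)))"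
    have L: "imem s1 ''W'' (imem s1 ''T'' 0) = L"
      using W[of T] by (simp add: fr1 in1 L_def)
    have layers: "wp layers (\<lambda>k s'. k \<le> n * T * (40 * (M + 1) + 150 * nat L + 100) + 10 \<and>
      imem s' ''m'' 0 = int (n * T) \<and> imem s' ''x'' 0 = int (n * T + 1) * L \<and>
      (\<forall>j<n * T. imem s' ''H'' (int j) = int (cell_pos j) \<and>
         cell_ok (rmem s' ''V'') (imem s' ''E'') (imem s' ''D'') j) \<and>
      (\<forall>x<L. rmem s' ''V'' x = 0)) ?s2"
      by (rule layers_spec)
        (simp_all add: fr1 in1 zero zeroV W input_cells input_capacity(1) input_capacity(2)[simplified] M_def)
    show ?case
    proof (simp add: L, rule wp_mono[OF layers], goal_cases)
      case (1 k2 s2)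
      then have k2: "k2 \<le> n * T * (40 * (M + 1) + 150 * nat L + 100) + 10"
        and m: "imem s2 ''m'' 0 = int (n * T)" and x: "imem s2 ''x'' 0 = int (n * T + 1) * L"
        and H: "\<And>j. j < n * T \<Longrightarrow> imem s2 ''H'' (int j) = int (cell_pos j)"
        and ok: "\<And>j. j < n * T \<Longrightarrow> cell_ok (rmem s2 ''V'') (imem s2 ''E'') (imem s2 ''D'') j"
        and V0: "\<And>x. x < L \<Longrightarrow> rmem s2 ''V'' x = 0"
        by auto
      \<comment> \<open>The traceback path: \<open>X j\<close> is the node reached from the final
        one when \<open>j\<close> cells remain.\<close>
      define X where "X j = ((imem s2 ''D'') ^^ (n * T - j)) (node (n * T) ?C False)" for j
      have XK: "X (n * T) = node (n * T) ?C False"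
        by (simp add: X_def)
      have Xstep: "X j = imem s2 ''D'' (X (Suc j))" if "j < n * T" for j
      proof -
        have "n * T - j = Suc (n * T - Suc j)" using that by simp
        then show ?thesis by (simp add: X_def)
      qed
      let ?s3 = "iupdate ''x'' 0 (imem s2 ''x'' 0 - 2) s2"
      have "node (n * T) ?C False = imem ?s3 ''x'' 0"
        by (simp add: node_def enc_capacity x algebra_simps)
      then have trace: "wp traceback (\<lambda>k s'. k \<le> n * T * 50 + 10 \<and>
          (\<forall>j<n * T. imem s' ''S'' (int (cell_pos j)) = imem ?s3 ''E'' (X (Suc j)))) ?s3"
        by (intro traceback_spec) (simp_all add: m H XK Xstep)
      show ?case
      proof (simp, rule wp_mono[OF trace], goal_cases)
        case (1 k3 s3)
        then have k3: "k3 \<le> n * T * 50 + 10"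
          and out: "\<And>j. j < n * T \<Longrightarrow> imem s3 ''S'' (int (cell_pos j)) = imem s2 ''E'' (X (Suc j))"
          by auto
        define S where "S = output_solution I s3"
        have S_sub: "S t \<subseteq> objects I" for t
          by (auto simp: S_def output_solution_def)
        have S_choice: "choices S j = (imem s2 ''E'' (X (Suc j)) = 1)" if "j < n * T" for j
          using that out[OF that] less_mult_imp_div_less[OF that]
          by (simp add: choices_def S_def output_solution_def objects_def cell_pos_def)
        have "feasible (choices S) (n * T) ?C \<and> gain (choices S) (n * T) False = rmem s2 ''V'' (X (n * T))"
          by (rule traceback_value[OF ok V0]) (use XK Xstep S_choice in auto)
        then have sol: "is_solution I S" and val: "solution_value I S = rmem s2 ''V'' (X (n * T))"
          using feasible_choices[of S] gain_choices[of S False] S_sub by auto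
        \<comment> \<open>A competitor is feasible for the full capacities, so its gain is at most
          the final value, which \<open>S\<close> attains.\<close>
        have "solution_value I S' \<le> solution_value I S" if "is_solution I S'" for S'
        proof -
          have sub: "\<And>t. t \<in> {1..T} \<Longrightarrow> S' t \<subseteq> objects I"
            using that by (auto simp: is_solution_def)
          then have "feasible (choices S') (n * T) ?C"
            using feasible_choices that by blast
          then have "gain (choices S') (n * T) False \<le> rmem s2 ''V'' (X (n * T))"
            unfolding XK by (intro gain_le_value[OF ok V0]) auto
          then show ?thesis
            using gain_choices[OF sub] val by simp
        qed
        then have "is_optimal_solution I S"
          using sol by (simp add: is_optimal_solution_def)
        then show ?case
          using k1 k2 k3 by (simp add: S_def cost_def)
      qed
    qed
  qed (simp_all add: in1 zero input_capacity(1) input_capacity(2)[simplified] M_def)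
  \<comment> \<open>Without objects the right side would be 0, yet the radices still take time,
    hence \<open>n \<ge> 1\<close>. Each summand is at most a multiple of \<open>n * T * P\<close>,
    and the multiples total less than 1000.\<close>
  moreover have "cost \<le> 1000 * (T * (2 * max_capacity I + 2) ^ T * n)" if "n \<ge> 1"
  proof -
    define P where "P = (2 * max_capacity I + 2) ^ T"
    have "2 * max_capacity I + 2 \<le> P"
      unfolding P_def using T by (intro self_le_power) auto
    then have M: "M + 1 \<le> P" "M \<le> P" "1 \<le> P" by (auto simp: M_def)
    have nT: "1 \<le> n * T" "T \<le> n * T" using that T by (auto simp: Suc_le_eq)
    have LP: "nat L \<le> P" using L_le by (simp add: P_def)
    have nTP: "n * T \<le> n * T * P" "1 \<le> n * T * P" "T * P \<le> n * T * P"
      using M nT by (auto simp: Suc_le_eq)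
    have "T * (30 * M + 50) \<le> T * (80 * P)"
      using M by (intro mult_left_mono) auto
    moreover have "n * T * (40 * (M + 1) + 150 * nat L + 100) \<le> n * T * (290 * P)"
      using M LP by (intro mult_left_mono) auto
    ultimately have "cost \<le> 1000 * (n * T * P)"
      unfolding cost_def using nTP by linarith
    then show ?thesis by (simp add: P_def ac_simps)
  qed
  ultimately show ?thesis
    unfolding wp_def by (meson order_trans)
qed

end

theorem theorem7:
  "\<exists>(prog :: com) (c :: nat). \<forall>I :: mk_instance. valid_instance I \<longrightarrow>
     (\<exists>k s. runs prog (input_state I) k s \<and>
            is_optimal_solution I (output_solution I s) \<and>
            (num_objects I \<ge> 1 \<longrightarrow>
               k \<le> c * (horizon I * (2 * max_capacity I + 2) ^ horizon I * num_objects I)))"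
proof (rule exI[of _ knapsack_program], rule exI[of _ 1000], intro allI impI)
  fix I :: mk_instance
  assume "valid_instance I"
  then interpret valid_knapsack I by unfold_locales
  show "\<exists>k s. runs knapsack_program (input_state I) k s \<and>
            is_optimal_solution I (output_solution I s) \<and>
            (num_objects I \<ge> 1 \<longrightarrow>
               k \<le> 1000 * (horizon I * (2 * max_capacity I + 2) ^ horizon I * num_objects I))"
    by (rule knapsack_program_correct)
qed

end
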